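(* Let $\gamma:[0,1]\to\mathbb{R}^d$ be a continuous path with derivative $f:(0,1)\to\mathbb{R}^d$ such that $\lVert f(t)\rVert_2=1$ for all $t\in(0,1)$. Suppose further that the modulus of continuity of $f$, $\delta(h):=\sup_{|u-v|\le h}\lVert f(u)-f(v)\rVert_2$, satisfies $\delta(h)=o(h^{3/4})$ as $h\to0$. Assume $\gamma$ is linear on an interval $[s,t]\subset[0,1]$ and let $\theta\in(s,t)$. For $n\ge1$ put $p=p(n)=\lfloor\theta(n+2)\rfloor$ (which lies in $\{1,\dots,n+1\}$ for all large $n$; only such $n$ are considered), and let $$x^*_{\theta,n}\in\operatorname*{argmin}_{x\in\mathbb{R}^d,\ \lVert x\rVert_2=1}\ \left\lVert I_{p,n}(x)-\bar S_{n+1}\right\rVert_\pi .$$ Then $x^*_{\theta,n}\to f(\theta)$ as $n\to\infty$.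
   Context: Normalised signature: $\bar S_n:=n!\int_{0<u_1<\cdots<u_n<1}f(u_1)\otimes\cdots\otimes f(u_n)\,du_1\cdots du_n\in(\mathbb{R}^d)^{\otimes n}$. Insertion map: for $p\in\{1,\dots,n+1\}$, $I_{p,n}:\mathbb{R}^d\to(\mathbb{R}^d)^{\otimes(n+1)}$ is $$I_{p,n}(x):=n!\int_{0<u_1<\cdots<u_n<1}f(u_1)\otimes\cdots\otimes f(u_{p-1})\otimes x\otimes f(u_p)\otimes\cdots\otimes f(u_n)\,du_1\cdots du_n .$$ $\lVert\cdot\rVert_2$ is the Euclidean norm, and $\lVert\cdot\rVert_\pi$ is the projective tensor norm on $(\mathbb{R}^d)^{\otimes k}$ induced by it: $\lVert x\rVert_\pi=\inf\sum_i\lVert v_{i,1}\rVert_2\cdots\lVert v_{i,k}\rVert_2$ over finite representations $x=\sum_i v_{i,1}\otimes\cdots\otimes v_{i,k}$. The argmin is nonempty; $x^*_{\theta,n}$ denotes any chosen minimiser. *)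

theory Defs
  imports "HOL-Analysis.Analysis" "HOL-Library.Landau_Symbols"
begin

text \<open>
  Since the order \<open>k\<close> of the tensors varies, a tensor of order \<open>k\<close> over \<open>real ^ 'd\<close> is given by
  its coordinates in the standard basis: a function on multi-indices \<open>is :: 'd list\<close> that vanishes
  unless \<open>length is = k\<close>. Subtraction of tensors is the pointwise one on functions.
\<close>

type_synonym 'd tensor = "'d list \<Rightarrow> real"

definition pure_tensor :: "(real ^ 'd::finite) list \<Rightarrow> 'd tensor" where
  "pure_tensor vs is =
     (if length is = length vs then (\<Prod>j<length vs. (vs ! j) $ (is ! j)) else 0)"

definition projective_norm :: "nat \<Rightarrow> 'd::finite tensor \<Rightarrow> real" where
  "projective_norm k T =
     Inf {(\<Sum>vs\<leftarrow>reps. \<Prod>v\<leftarrow>vs. norm v) | reps :: (real ^ 'd) list list.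
            (\<forall>vs\<in>set reps. length vs = k) \<and> T = (\<lambda>is. \<Sum>vs\<leftarrow>reps. pure_tensor vs is)}"

definition open_simplex :: "nat \<Rightarrow> (nat \<Rightarrow> real) set" where
  "open_simplex n = {u \<in> {1..n} \<rightarrow>\<^sub>E {0<..<1}. strict_mono_on {1..n} u}"

text \<open>Tensor-valued integrals are taken coordinatewise.\<close>

definition simplex_integral :: "nat \<Rightarrow> ((nat \<Rightarrow> real) \<Rightarrow> 'd tensor) \<Rightarrow> 'd tensor" where
  "simplex_integral n F is =
     (LINT u:open_simplex n|(\<Pi>\<^sub>M i\<in>{1..n}. lborel). F u is)"

definition normalised_signature :: "(real \<Rightarrow> real ^ 'd::finite) \<Rightarrow> nat \<Rightarrow> 'd tensor" where
  "normalised_signature f n is =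
     fact n * simplex_integral n (\<lambda>u. pure_tensor (map (\<lambda>i. f (u i)) [1..<Suc n])) is"

definition insertion ::
    "(real \<Rightarrow> real ^ 'd::finite) \<Rightarrow> nat \<Rightarrow> nat \<Rightarrow> real ^ 'd \<Rightarrow> 'd tensor" where
  "insertion f p n x is =
     fact n * simplex_integral n
       (\<lambda>u. pure_tensor (map (\<lambda>i. f (u i)) [1..<p] @ [x] @ map (\<lambda>i. f (u i)) [p..<Suc n])) is"

definition modulus_of_continuity :: "(real \<Rightarrow> 'a::real_normed_vector) \<Rightarrow> real \<Rightarrow> real" where
  "modulus_of_continuity f h =
     (SUP (u, v)\<in>{(u, v). u \<in> {0<..<1} \<and> v \<in> {0<..<1} \<and> \<bar>u - v\<bar> \<le> h}. norm (f u - f v))"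

definition linear_on_interval :: "(real \<Rightarrow> 'a::real_vector) \<Rightarrow> real \<Rightarrow> real \<Rightarrow> bool" where
  "linear_on_interval \<gamma> s t \<longleftrightarrow> (\<exists>a b. \<forall>u\<in>{s..t}. \<gamma> u = a + u *\<^sub>R b)"

end

theory Submission
  imports Defs "HOL-Real_Asymp.Real_Asymp"
begin

text \<open>
  On \<open>(s, t)\<close> the derivative \<open>f\<close> is a constant unit vector \<open>b\<close>. Write \<open>S\<close> for the normalised signature
  of order \<open>n + 1\<close> and \<open>I x\<close> for the insertion of \<open>x\<close> at position \<open>p\<close>. The proof compares a candidate
  \<open>x\<close> with \<open>b\<close>: an upper bound shows that \<open>I b - S\<close> tends to \<open>0\<close> in the projective norm, hence so does
  \<open>I x - S\<close> for a minimiser \<open>x\<close>, and a lower bound shows that \<open>I x\<close> cannot be close to \<open>I b\<close> unless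
  \<open>x\<close> is close to \<open>b\<close>.

  Both \<open>S\<close> and \<open>I x\<close> are expectations. Let \<open>U 1 < \<dots> < U n\<close> be the order statistics of \<open>n\<close> independent
  uniform points; their law is \<open>n!\<close> times Lebesgue measure on the simplex. Then \<open>S\<close> is the expectation
  of \<open>f (U 1) \<otimes> \<dots> \<otimes> f (U (n + 1))\<close> and \<open>I x\<close> that of a similar word with \<open>x\<close> inserted. All the
  probability needed comes from one identity (\<open>distr_del_pt\<close>): deleting the \<open>q\<close>-th of \<open>n + 1\<close> points gives
  the law of \<open>n\<close> points with density \<open>(n + 1)\<close> times the length of the \<open>q\<close>-th gap. It yields
  the first two moments of all gaps, and it relates \<open>S\<close> to \<open>I b\<close>.

  Upper bound (\<open>insertion_error_tendsto_0\<close>). If \<open>U p\<close> and \<open>U q\<close> lie in \<open>(s, t)\<close>, then all points between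
  them contribute the same factor \<open>b\<close>, and deleting the \<open>q\<close>-th point and inserting \<open>b\<close> at position \<open>p\<close>
  does not change the word. So \<open>S\<close> is, up to the probability that these points leave \<open>(s, t)\<close>, the
  expectation of \<open>(n + 1) * gap q\<close> times the word of \<open>I b\<close>. Each single weight \<open>(n + 1) * gap q\<close> fluctuates,
  but its average over \<open>m\<close> consecutive values of \<open>q\<close> deviates from \<open>1\<close> by at most \<open>1 / sqrt m\<close> in mean.
  As \<open>p / n\<close> tends to \<open>\<theta>\<close>, the points concentrate at \<open>\<theta>\<close>; let \<open>n\<close> and then \<open>m\<close> tend to infinity.

  Lower bound (\<open>insertion_separation\<close>). The multilinear form that takes the inner product of slot \<open>p\<close> with \<open>b\<close>
  and contracts the other slots in consecutive pairs has norm at most \<open>1\<close> for the projective norm. It maps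
  \<open>I x\<close> to \<open>x \<bullet> b\<close> times the expectation of a product of inner products \<open>f (U i) \<bullet> f (U (i + 1))\<close> over
  disjoint pairs of neighbours (an unpaired last factor is contracted with a fixed unit vector). For unit
  vectors \<open>1 - v \<bullet> w\<close> is half the squared distance, and the modulus of continuity bounds squared
  distances by \<open>e * gap + K * gap\<^sup>2\<close>, for every \<open>e > 0\<close> and a suitable \<open>K\<close>. The gaps sum to \<open>1\<close> and their squares to \<open>O(1 / n)\<close> in mean,
  so the expectation is at least \<open>1/2\<close> for large \<open>n\<close> (\<open>expectation_pairing_ge\<close>). Therefore \<open>x \<bullet> b\<close> tends to \<open>1\<close>, which for
  unit vectors means that \<open>x\<close> tends to \<open>b\<close>.
\<close>

section \<open>The projective norm in coordinates\<close>

definition of_order :: "nat \<Rightarrow> 'd tensor \<Rightarrow> bool" where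
  "of_order k T \<longleftrightarrow> (\<forall>is. length is \<noteq> k \<longrightarrow> T is = 0)"

text \<open>
  The cost of a single representation: estimates are made for concrete representations, which can be
  concatenated, and pass to the infimum only at the end.
\<close>

definition tensor_cost :: "nat \<Rightarrow> 'd::finite tensor \<Rightarrow> real \<Rightarrow> bool" where
  "tensor_cost k T r \<longleftrightarrow> (\<exists>reps :: (real ^ 'd) list list. (\<forall>vs\<in>set reps. length vs = k) \<and>
     T = (\<lambda>is. \<Sum>vs\<leftarrow>reps. pure_tensor vs is) \<and> r = (\<Sum>vs\<leftarrow>reps. \<Prod>v\<leftarrow>vs. norm v))"

lemma projective_norm_eq: "projective_norm k T = Inf {r. tensor_cost k T r}"
  unfolding projective_norm_def tensor_cost_def by (rule arg_cong[where f = Inf]) (rule Collect_cong, blast)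

lemma prod_list_nonneg: "(\<And>x. x \<in> set xs \<Longrightarrow> 0 \<le> x) \<Longrightarrow> 0 \<le> prod_list (xs :: real list)"
  by (induction xs) auto

lemma tensor_cost_nonneg: "tensor_cost k T r \<Longrightarrow> 0 \<le> r"
  unfolding tensor_cost_def by (auto intro!: sum_list_nonneg prod_list_nonneg)

lemma tensor_cost_zero: "tensor_cost k (\<lambda>_. 0) 0"
  unfolding tensor_cost_def by (rule exI[of _ "[]"]) auto

lemma tensor_cost_add:
  fixes S T :: "'d::finite tensor"
  assumes "tensor_cost k S r" "tensor_cost k T r'"
  shows "tensor_cost k (\<lambda>is. S is + T is) (r + r')"
proof -
  obtain A :: "(real ^ 'd) list list" where A:
    "\<forall>vs\<in>set A. length vs = k" "S = (\<lambda>is. \<Sum>vs\<leftarrow>A. pure_tensor vs is)" "r = (\<Sum>vs\<leftarrow>A. \<Prod>v\<leftarrow>vs. norm v)"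
    using assms(1) unfolding tensor_cost_def by blast
  obtain B :: "(real ^ 'd) list list" where B:
    "\<forall>vs\<in>set B. length vs = k" "T = (\<lambda>is. \<Sum>vs\<leftarrow>B. pure_tensor vs is)" "r' = (\<Sum>vs\<leftarrow>B. \<Prod>v\<leftarrow>vs. norm v)"
    using assms(2) unfolding tensor_cost_def by blast
  show ?thesis unfolding tensor_cost_def
    by (rule exI[of _ "A @ B"]) (use A B in auto)
qed

lemma pure_tensor_Nil: "pure_tensor [] is = (if is = [] then 1 else 0)"
  by (simp add: pure_tensor_def)

lemma pure_tensor_Cons_Nil [simp]: "pure_tensor (v # vs) [] = 0"
  by (simp add: pure_tensor_def)

lemma pure_tensor_Cons [simp]: "pure_tensor (v # vs) (i # is) = v $ i * pure_tensor vs is"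
  by (simp add: pure_tensor_def prod.lessThan_Suc_shift del: prod.lessThan_Suc)

lemma pure_tensor_scale_hd: "pure_tensor ((a *\<^sub>R v) # vs) is = a * pure_tensor (v # vs) is"
  by (cases "is") auto

text \<open>
  A scalar has to be absorbed into one of the factors, which is why the order must be positive:
  a tensor of order \<open>0\<close> that has a representation is a natural number.
\<close>

lemma tensor_cost_scaled_pure:
  assumes "length vs = k" "0 < k"
  shows "tensor_cost k (\<lambda>is. a * pure_tensor vs is) (\<bar>a\<bar> * (\<Prod>v\<leftarrow>vs. norm v))"
proof -
  obtain v ws where vs: "vs = v # ws" using assms by (cases vs) auto
  show ?thesis unfolding tensor_cost_def
    by (rule exI[of _ "[(a *\<^sub>R v) # ws]"]) (use assms in \<open>auto simp: vs pure_tensor_scale_hd\<close>)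
qed

lemma tensor_cost_sum_pure:
  assumes "finite Z" "\<And>z. z \<in> Z \<Longrightarrow> length (vs z) = k" "0 < k"
  shows "tensor_cost k (\<lambda>is. \<Sum>z\<in>Z. a z * pure_tensor (vs z) is) (\<Sum>z\<in>Z. \<bar>a z\<bar> * (\<Prod>v\<leftarrow>vs z. norm v))"
  using assms(1,2)
proof (induction Z rule: finite_induct)
  case empty
  then show ?case by (simp add: tensor_cost_zero)
next
  case (insert z Z)
  then show ?case
    using tensor_cost_add[OF tensor_cost_scaled_pure[of "vs z" k "a z"] insert.IH] assms(3) by simp
qed

lemma tensor_cost_bdd_below: "bdd_below {r. tensor_cost k T r}"
  by (rule bdd_belowI[of _ 0]) (auto dest: tensor_cost_nonneg)

lemma projective_norm_le_cost: "tensor_cost k T r \<Longrightarrow> projective_norm k T \<le> r"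
  unfolding projective_norm_eq by (rule cInf_lower) (auto simp: tensor_cost_bdd_below)

lemma finite_multi_indices: "finite {is :: 'd::finite list. length is = k}"
  using finite_lists_length_eq[of "UNIV :: 'd set" k] by simp

lemma pure_tensor_axes:
  "pure_tensor (map (\<lambda>j. axis j 1) js) is = (if is = js then 1 else 0)"
proof (induction js arbitrary: "is")
  case Nil
  then show ?case by (simp add: pure_tensor_Nil)
next
  case (Cons j js)
  then show ?case by (cases "is") (auto simp: axis_def)
qed

text \<open>
  The expansion in the standard basis shows that every tensor of positive order has a representation, so the infimum
  in the projective norm is never taken over the empty set.
\<close>

lemma tensor_cost_coordinates:
  fixes T :: "'d::finite tensor"
  assumes T: "of_order k T" and k: "0 < k"
  shows "tensor_cost k T (\<Sum>is | length is = k. \<bar>T is\<bar>)"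
proof -
  let ?Z = "{is :: 'd list. length is = k}"
  let ?e = "\<lambda>js. map (\<lambda>j. axis j (1::real) :: real ^ 'd) js"
  have fin: "finite ?Z" by (rule finite_multi_indices)
  have cost: "tensor_cost k (\<lambda>is. \<Sum>js\<in>?Z. T js * pure_tensor (?e js) is)
      (\<Sum>js\<in>?Z. \<bar>T js\<bar> * (\<Prod>v\<leftarrow>?e js. norm v))"
    by (rule tensor_cost_sum_pure[OF fin]) (use k in auto)
  have "(\<Sum>js\<in>?Z. T js * pure_tensor (?e js) is) = T is" for "is"
  proof -
    have "(\<Sum>js\<in>?Z. T js * pure_tensor (?e js) is) = (\<Sum>js\<in>?Z. if is = js then T js else 0)"
      by (rule sum.cong) (auto simp: pure_tensor_axes)
    also have "\<dots> = (if is \<in> ?Z then T is else 0)" by (rule sum.delta'[OF fin])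
    also have "\<dots> = T is" using T by (auto simp: of_order_def)
    finally show ?thesis .
  qed
  then have eq: "(\<lambda>is. \<Sum>js\<in>?Z. T js * pure_tensor (?e js) is) = T" by (rule ext)
  have "(\<Prod>v\<leftarrow>?e js. norm v) = 1" for js
    by (induction js) auto
  then show ?thesis using cost unfolding eq by simp
qed

lemma projective_norm_approx:
  assumes T: "of_order k T" and k: "0 < k" and e: "0 < e"
  obtains r where "tensor_cost k T r" "r < projective_norm k T + e"
proof -
  have "tensor_cost k T (\<Sum>is | length is = k. \<bar>T is\<bar>)"
    by (rule tensor_cost_coordinates[OF T k])
  then have ne: "{r. tensor_cost k T r} \<noteq> {}" by auto
  have "Inf {r. tensor_cost k T r} < projective_norm k T + e"
    using e by (simp only: projective_norm_eq less_add_same_cancel1)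
  from cInf_lessD[OF ne this] obtain r where "tensor_cost k T r" "r < projective_norm k T + e"
    by auto
  then show ?thesis by (rule that)
qed

lemma projective_norm_triangle:
  assumes "of_order k S" "of_order k T" and k: "0 < k"
  shows "projective_norm k (\<lambda>is. S is + T is) \<le> projective_norm k S + projective_norm k T"
proof (rule field_le_epsilon)
  fix e :: real assume e: "0 < e"
  obtain r where r: "tensor_cost k S r" "r < projective_norm k S + e / 2"
    using projective_norm_approx[OF assms(1) k, where e = "e / 2"] e by auto
  obtain r' where r': "tensor_cost k T r'" "r' < projective_norm k T + e / 2"
    using projective_norm_approx[OF assms(2) k, where e = "e / 2"] e by auto
  have "projective_norm k (\<lambda>is. S is + T is) \<le> r + r'"
    using r r' by (intro projective_norm_le_cost tensor_cost_add)
  then show "projective_norm k (\<lambda>is. S is + T is) \<le> projective_norm k S + projective_norm k T + e"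
    using r r' by linarith
qed

lemma projective_norm_le_coordinates:
  assumes "of_order k T" "0 < k"
  shows "projective_norm k T \<le> (\<Sum>is | length is = k. \<bar>T is\<bar>)"
  by (rule projective_norm_le_cost) (use assms in \<open>rule tensor_cost_coordinates\<close>)

text \<open>
  This is the easy half of the duality between the projective norm and bounded multilinear forms.
  A form is given by its coordinates \<open>c\<close>.
\<close>

lemma functional_le_projective_norm:
  fixes T :: "'d::finite tensor"
  assumes T: "of_order k T" and k: "0 < k"
    and contr: "\<And>vs :: (real ^ 'd) list. length vs = k \<Longrightarrow>
      \<bar>\<Sum>is | length is = k. pure_tensor vs is * c is\<bar> \<le> (\<Prod>v\<leftarrow>vs. norm v)"
  shows "\<bar>\<Sum>is | length is = k. T is * c is\<bar> \<le> projective_norm k T"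
proof (rule field_le_epsilon)
  fix e :: real assume e: "0 < e"
  obtain r where r: "tensor_cost k T r" "r < projective_norm k T + e"
    using projective_norm_approx[OF T k e] by blast
  obtain reps :: "(real ^ 'd) list list" where
    R: "\<forall>vs\<in>set reps. length vs = k" "T = (\<lambda>is. \<Sum>vs\<leftarrow>reps. pure_tensor vs is)" "r = (\<Sum>vs\<leftarrow>reps. \<Prod>v\<leftarrow>vs. norm v)"
    using r(1) unfolding tensor_cost_def by blast
  have "\<bar>\<Sum>is | length is = k. (\<Sum>vs\<leftarrow>reps. pure_tensor vs is) * c is\<bar> \<le> (\<Sum>vs\<leftarrow>reps. \<Prod>v\<leftarrow>vs. norm v)"
    using R(1)
  proof (induction reps)
    case (Cons vs reps)
    have "(\<Sum>is | length is = k. (\<Sum>vs\<leftarrow>vs # reps. pure_tensor vs is) * c is) =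
      (\<Sum>is | length is = k. pure_tensor vs is * c is) + (\<Sum>is | length is = k. (\<Sum>vs\<leftarrow>reps. pure_tensor vs is) * c is)"
      by (simp add: algebra_simps sum.distrib)
    then show ?case using Cons contr[of vs] by fastforce
  qed simp
  then show "\<bar>\<Sum>is | length is = k. T is * c is\<bar> \<le> projective_norm k T + e"
    using R r by simp
qed

section \<open>The projective norm of an expected pure tensor\<close>

text \<open>
  Simple functions that approximate a function with values in the unit ball may leave the ball.
  Composing with this retraction brings them back, without spoiling the convergence.
\<close>

definition unit_ball_retract :: "'a::real_normed_vector \<Rightarrow> 'a" where
  "unit_ball_retract v = v /\<^sub>R max 1 (norm v)"

lemma norm_unit_ball_retract: "norm (unit_ball_retract v) \<le> 1"
  by (simp add: unit_ball_retract_def field_simps)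

lemma unit_ball_retract_id: "norm v \<le> 1 \<Longrightarrow> unit_ball_retract v = v"
  by (simp add: unit_ball_retract_def max_def)

lemma tendsto_unit_ball_retract:
  assumes "(g \<longlongrightarrow> v) F" "norm v \<le> 1"
  shows "((\<lambda>x. unit_ball_retract (g x)) \<longlongrightarrow> v) F"
proof -
  have "((\<lambda>x. unit_ball_retract (g x)) \<longlongrightarrow> unit_ball_retract v) F"
    unfolding unit_ball_retract_def using assms by (intro tendsto_intros) auto
  then show ?thesis using assms by (simp add: unit_ball_retract_id)
qed

lemma abs_pure_tensor_le_1:
  assumes "\<And>v. v \<in> set vs \<Longrightarrow> norm v \<le> 1"
  shows "\<bar>pure_tensor vs is\<bar> \<le> 1"
  using assms
proof (induction vs arbitrary: "is")
  case (Cons v vs)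
  show ?case
  proof (cases "is")
    case (Cons i js)
    have "\<bar>v $ i\<bar> \<le> 1" using component_le_norm_cart[of v i] Cons.prems by (simp add: order_trans)
    then have "\<bar>v $ i\<bar> * \<bar>pure_tensor vs js\<bar> \<le> 1 * 1"
      using Cons.IH Cons.prems by (intro mult_mono) auto
    then show ?thesis by (simp add: Cons abs_mult)
  qed simp
qed (simp add: pure_tensor_Nil)

lemma prod_list_norm_le_1:
  "(\<And>v. v \<in> set vs \<Longrightarrow> norm v \<le> 1) \<Longrightarrow> (\<Prod>v\<leftarrow>vs. norm v) \<le> 1"
proof (induction vs)
  case (Cons v vs)
  then have "norm v * (\<Prod>v\<leftarrow>vs. norm v) \<le> 1 * 1"
    by (intro mult_mono prod_list_nonneg) auto
  then show ?case by simp
qed simp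

lemma pure_tensor_map:
  "pure_tensor (map g [0..<k]) is = (if length is = k then \<Prod>j<k. g j $ (is ! j) else 0)"
  by (auto simp: pure_tensor_def intro!: prod.cong)

lemma pure_tensor_map_measurable:
  fixes g :: "nat \<Rightarrow> 'a \<Rightarrow> real ^ 'd::finite"
  assumes "\<And>j. j < k \<Longrightarrow> g j \<in> borel_measurable M"
  shows "(\<lambda>\<omega>. pure_tensor (map (\<lambda>j. g j \<omega>) [0..<k]) is) \<in> borel_measurable M"
proof -
  have "(\<lambda>\<omega>. g j \<omega> $ i) \<in> borel_measurable M" if "j < k" for j i
    using assms[OF that] by (rule measurable_compose) (simp add: borel_measurable_nth)
  then show ?thesis unfolding pure_tensor_map by (cases "length is = k") (auto intro!: borel_measurable_prod)
qed

text \<open>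
  A representation is a finite sum, whereas the integral is a limit of such sums. When all factors
  are simple functions, the integral is the finite sum over their values, whose cost is at most
  \<open>\<integral>\<bar>w\<bar>\<close>. In general the factors are approximated pointwise by simple functions in the unit ball; dominated
  convergence gives convergence of the coordinates, which is convergence in the projective
  norm because there are only finitely many of them.
\<close>

lemma projective_norm_integral_le:
  fixes g :: "nat \<Rightarrow> 'a \<Rightarrow> real ^ 'd::finite"
  assumes k: "0 < k"
    and g: "\<And>j. j < k \<Longrightarrow> g j \<in> borel_measurable M"
    and g1: "\<And>j \<omega>. j < k \<Longrightarrow> \<omega> \<in> space M \<Longrightarrow> norm (g j \<omega>) \<le> 1"
    and w: "integrable M w"
  shows "projective_norm k (\<lambda>is. \<integral>\<omega>. w \<omega> * pure_tensor (map (\<lambda>j. g j \<omega>) [0..<k]) is \<partial>M) \<le> (\<integral>\<omega>. \<bar>w \<omega>\<bar> \<partial>M)"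
    (is "projective_norm k ?T \<le> _")
proof -
  have "\<exists>F. \<forall>j<k. (\<forall>N. simple_function M (F j N)) \<and> (\<forall>x\<in>space M. (\<lambda>N. F j N x) \<longlonglongrightarrow> g j x)"
  proof -
    have "\<forall>j. \<exists>F. j < k \<longrightarrow> (\<forall>N. simple_function M (F N)) \<and> (\<forall>x\<in>space M. (\<lambda>N. F N x) \<longlonglongrightarrow> g j x)"
      using borel_measurable_implies_sequence_metric[OF g] by blast
    then show ?thesis by metis
  qed
  then obtain F where F: "\<And>j N. j < k \<Longrightarrow> simple_function M (F j N)"
    and F_lim: "\<And>j x. j < k \<Longrightarrow> x \<in> space M \<Longrightarrow> (\<lambda>N. F j N x) \<longlonglongrightarrow> g j x"
    by blast
  define G where "G N j x = unit_ball_retract (F j N x)" for N j x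
  define L where "L N x = map (\<lambda>j. G N j x) [0..<k]" for N x
  define T where "T N is = (\<integral>\<omega>. w \<omega> * pure_tensor (L N \<omega>) is \<partial>M)" for N "is"
  have Gs: "simple_function M (G N j)" if "j < k" for N j
    unfolding G_def[abs_def] by (rule simple_function_compose1[OF F[OF that]])
  have G1: "norm v \<le> 1" if "v \<in> set (L N x)" for v N x
    using that by (auto simp: L_def G_def norm_unit_ball_retract)
  have Ls: "simple_function M (L N)" for N
  proof -
    have "simple_function M (\<lambda>x. map (\<lambda>j. G N j x) [0..<m])" if "m \<le> k" for m
      using that
    proof (induction m)
      case (Suc m)
      then show ?case
        using simple_function_compose2[of M "\<lambda>x. map (\<lambda>j. G N j x) [0..<m]" "G N m" "\<lambda>xs x. xs @ [x]"] Gs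
        by simp
    qed (simp add: simple_function_const)
    then show ?thesis by (simp add: L_def[abs_def])
  qed
  have len: "length (L N x) = k" for N x by (simp add: L_def)
  have pm: "(\<lambda>\<omega>. pure_tensor (L N \<omega>) is) \<in> borel_measurable M" for N "is"
    by (rule borel_measurable_simple_function) (rule simple_function_compose1[OF Ls])
  have wm: "w \<in> borel_measurable M" using w by simp
  have bound: "\<bar>w \<omega> * pure_tensor (L N \<omega>) is\<bar> \<le> \<bar>w \<omega>\<bar>" for N \<omega> "is"
    using abs_pure_tensor_le_1[of "L N \<omega>" "is"] G1 by (simp add: abs_mult mult_left_le)
  have T_le: "projective_norm k (T N) \<le> (\<integral>\<omega>. \<bar>w \<omega>\<bar> \<partial>M)" for N
  proof -
    let ?Z = "L N ` space M"
    let ?a = "\<lambda>z. \<integral>\<omega>. w \<omega> * indicator (L N -` {z} \<inter> space M) \<omega> \<partial>M"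
    have fin: "finite ?Z" using Ls simple_functionD(1) by blast
    have ms: "L N -` {z} \<inter> space M \<in> sets M" for z
      using Ls by (rule simple_functionD(2))
    have int: "integrable M (\<lambda>\<omega>. w \<omega> * indicator (L N -` {z} \<inter> space M) \<omega>)" for z
      using integrable_real_mult_indicator[OF ms w] by simp
    have "T N is = (\<Sum>z\<in>?Z. ?a z * pure_tensor z is)" for "is"
    proof -
      have "T N is = (\<integral>\<omega>. (\<Sum>z\<in>?Z. w \<omega> * indicator (L N -` {z} \<inter> space M) \<omega> * pure_tensor z is) \<partial>M)"
        unfolding T_def
      proof (rule Bochner_Integration.integral_cong[OF refl])
        fix \<omega> assume \<omega>: "\<omega> \<in> space M"
        have "(\<Sum>z\<in>?Z. w \<omega> * indicator (L N -` {z} \<inter> space M) \<omega> * pure_tensor z is)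
           = (\<Sum>z\<in>?Z. if z = L N \<omega> then w \<omega> * pure_tensor z is else 0)"
          using \<omega> by (intro sum.cong) (auto simp: indicator_def)
        then show "w \<omega> * pure_tensor (L N \<omega>) is = (\<Sum>z\<in>?Z. w \<omega> * indicator (L N -` {z} \<inter> space M) \<omega> * pure_tensor z is)"
          using \<omega> fin by simp
      qed
      then show ?thesis using int by simp
    qed
    then have "T N = (\<lambda>is. \<Sum>z\<in>?Z. ?a z * pure_tensor z is)" by (rule ext)
    moreover have "tensor_cost k (\<lambda>is. \<Sum>z\<in>?Z. ?a z * pure_tensor z is) (\<Sum>z\<in>?Z. \<bar>?a z\<bar> * (\<Prod>v\<leftarrow>z. norm v))"
      by (rule tensor_cost_sum_pure[OF fin]) (auto simp: len k)
    ultimately have "projective_norm k (T N) \<le> (\<Sum>z\<in>?Z. \<bar>?a z\<bar> * (\<Prod>v\<leftarrow>z. norm v))"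
      by (simp add: projective_norm_le_cost)
    also have "\<dots> \<le> (\<Sum>z\<in>?Z. (\<integral>\<omega>. \<bar>w \<omega>\<bar> * indicator (L N -` {z} \<inter> space M) \<omega> \<partial>M) * 1)"
    proof (intro sum_mono mult_mono)
      fix z assume z: "z \<in> ?Z"
      show "\<bar>?a z\<bar> \<le> (\<integral>\<omega>. \<bar>w \<omega>\<bar> * indicator (L N -` {z} \<inter> space M) \<omega> \<partial>M)"
        using integral_abs_bound[of M "\<lambda>\<omega>. w \<omega> * indicator (L N -` {z} \<inter> space M) \<omega>"]
        by (simp add: abs_mult)
      show "(\<Prod>v\<leftarrow>z. norm v) \<le> 1"
        using z G1 by (intro prod_list_norm_le_1) auto
    qed (auto intro!: prod_list_nonneg)
    also have "\<dots> = (\<integral>\<omega>. (\<Sum>z\<in>?Z. \<bar>w \<omega>\<bar> * indicator (L N -` {z} \<inter> space M) \<omega>) \<partial>M)"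
      using integrable_real_mult_indicator[OF ms integrable_abs[OF w]] by simp
    also have "\<dots> = (\<integral>\<omega>. \<bar>w \<omega>\<bar> \<partial>M)"
    proof (rule Bochner_Integration.integral_cong[OF refl])
      fix \<omega> assume \<omega>: "\<omega> \<in> space M"
      have "(\<Sum>z\<in>?Z. \<bar>w \<omega>\<bar> * indicator (L N -` {z} \<inter> space M) \<omega>) = (\<Sum>z\<in>?Z. if z = L N \<omega> then \<bar>w \<omega>\<bar> else 0)"
        using \<omega> by (intro sum.cong) (auto simp: indicator_def)
      then show "(\<Sum>z\<in>?Z. \<bar>w \<omega>\<bar> * indicator (L N -` {z} \<inter> space M) \<omega>) = \<bar>w \<omega>\<bar>"
        using \<omega> fin by simp
    qed
    finally show ?thesis .
  qed
  have T_lim: "(\<lambda>N. T N is) \<longlonglongrightarrow> ?T is" for "is"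
    unfolding T_def
  proof (rule integral_dominated_convergence)
    show "(\<lambda>\<omega>. w \<omega> * pure_tensor (map (\<lambda>j. g j \<omega>) [0..<k]) is) \<in> borel_measurable M"
      using pure_tensor_map_measurable[OF g] wm by auto
    show "(\<lambda>\<omega>. w \<omega> * pure_tensor (L N \<omega>) is) \<in> borel_measurable M" for N
      using pm wm by auto
    show "integrable M (\<lambda>\<omega>. \<bar>w \<omega>\<bar>)" using w by simp
    show "AE x in M. norm (w x * pure_tensor (L N x) is) \<le> \<bar>w x\<bar>" for N using bound by simp
    show "AE x in M. (\<lambda>N. w x * pure_tensor (L N x) is) \<longlonglongrightarrow> w x * pure_tensor (map (\<lambda>j. g j x) [0..<k]) is"
    proof (rule AE_I2)
      fix x assume x: "x \<in> space M"
      have "(\<lambda>N. G N j x) \<longlonglongrightarrow> g j x" if "j < k" for j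
        unfolding G_def by (rule tendsto_unit_ball_retract[OF F_lim[OF that x] g1[OF that x]])
      then have "(\<lambda>N. pure_tensor (L N x) is) \<longlonglongrightarrow> pure_tensor (map (\<lambda>j. g j x) [0..<k]) is"
        unfolding L_def pure_tensor_map by (auto intro!: tendsto_prod tendsto_vec_nth)
      then show "(\<lambda>N. w x * pure_tensor (L N x) is) \<longlonglongrightarrow> w x * pure_tensor (map (\<lambda>j. g j x) [0..<k]) is"
        by (intro tendsto_mult tendsto_const)
    qed
  qed
  have T0: "of_order k (T N)" for N
    by (simp add: of_order_def T_def L_def pure_tensor_map)
  have D0: "of_order k (\<lambda>is. ?T is - T N is)" for N
    by (simp add: of_order_def T_def L_def pure_tensor_map)
  have "projective_norm k ?T \<le> (\<integral>\<omega>. \<bar>w \<omega>\<bar> \<partial>M) + (\<Sum>is | length is = k. \<bar>?T is - T N is\<bar>)" for N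
  proof -
    have "projective_norm k (\<lambda>is. T N is + (?T is - T N is)) \<le> projective_norm k (T N) + projective_norm k (\<lambda>is. ?T is - T N is)"
      by (rule projective_norm_triangle) (use k T0 D0 in auto)
    moreover have "projective_norm k (\<lambda>is. ?T is - T N is) \<le> (\<Sum>is | length is = k. \<bar>?T is - T N is\<bar>)"
      by (rule projective_norm_le_coordinates) (use k T0 D0 in auto)
    ultimately show ?thesis using T_le[of N] by simp
  qed
  moreover have "(\<lambda>N. (\<integral>\<omega>. \<bar>w \<omega>\<bar> \<partial>M) + (\<Sum>is | length is = k. \<bar>?T is - T N is\<bar>))
      \<longlonglongrightarrow> (\<integral>\<omega>. \<bar>w \<omega>\<bar> \<partial>M) + (\<Sum>is\<in>{is. length is = k}. \<bar>?T is - ?T is\<bar>)"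
    by (intro tendsto_intros T_lim)
  ultimately show ?thesis
    by (intro LIMSEQ_le_const[of _ "\<integral>\<omega>. \<bar>w \<omega>\<bar> \<partial>M"]) auto
qed


section \<open>Order statistics of uniform points\<close>

definition cube_measure :: "nat \<Rightarrow> (nat \<Rightarrow> real) measure" where
  "cube_measure n = (\<Pi>\<^sub>M i\<in>{1..n}. lborel)"

definition order_stats :: "nat \<Rightarrow> (nat \<Rightarrow> real) measure" where
  "order_stats n =
     density (cube_measure n) (\<lambda>u. ennreal (fact n * indicator (open_simplex n) u))"

text \<open>
  The points \<open>u 1 < \<dots> < u n\<close> are completed by \<open>u 0 = 0\<close> and \<open>u (n + 1) = 1\<close>, so that there are
  \<open>n + 1\<close> gaps with total length \<open>1\<close>.
\<close>

definition node :: "nat \<Rightarrow> (nat \<Rightarrow> real) \<Rightarrow> nat \<Rightarrow> real" where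
  "node n u i = (if i = 0 then 0 else if i \<le> n then u i else 1)"

definition gap :: "nat \<Rightarrow> (nat \<Rightarrow> real) \<Rightarrow> nat \<Rightarrow> real" where
  "gap n u i = node n u i - node n u (i - 1)"

definition del_pt :: "nat \<Rightarrow> nat \<Rightarrow> (nat \<Rightarrow> real) \<Rightarrow> nat \<Rightarrow> real" where
  "del_pt n q u = (\<lambda>i\<in>{1..n}. if i < q then u i else u (Suc i))"

definition ins_pt :: "nat \<Rightarrow> nat \<Rightarrow> real \<Rightarrow> (nat \<Rightarrow> real) \<Rightarrow> nat \<Rightarrow> real" where
  "ins_pt n q y u = (\<lambda>i\<in>{1..Suc n}. if i < q then u i else if i = q then y else u (i - 1))"

lemma open_simplex_iff:
  "u \<in> open_simplex n \<longleftrightarrow> u \<in> extensional {1..n} \<and> (\<forall>i\<in>{1..n}. 0 < u i \<and> u i < 1) \<and>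
     (\<forall>i\<in>{1..n}. \<forall>j\<in>{1..n}. i < j \<longrightarrow> u i < u j)"
  unfolding open_simplex_def strict_mono_on_def PiE_def by auto

lemma space_cube_measure: "space (cube_measure n) = extensional {1..n}"
  by (auto simp: cube_measure_def space_PiM PiE_def)

lemma measurable_coord [measurable]:
  "1 \<le> i \<Longrightarrow> i \<le> n \<Longrightarrow> (\<lambda>u. u i) \<in> borel_measurable (cube_measure n)"
  using measurable_component_singleton[of i "{1..n}" "\<lambda>_. lborel :: real measure"]
  by (simp add: cube_measure_def)

lemma open_simplex_measurable [measurable]:
  "open_simplex n \<in> sets (cube_measure n)"
proof -
  have "open_simplex n = {u \<in> space (cube_measure n).
      (\<forall>i\<in>{1..n}. 0 < u i \<and> u i < 1) \<and> (\<forall>i\<in>{1..n}. \<forall>j\<in>{1..n}. i < j \<longrightarrow> u i < u j)}"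
    by (auto simp: open_simplex_iff space_cube_measure)
  also have "\<dots> \<in> sets (cube_measure n)"
    by measurable
  finally show ?thesis .
qed

lemma space_order_stats [simp]: "space (order_stats n) = space (cube_measure n)"
  and sets_order_stats [measurable_cong, simp]:
    "sets (order_stats n) = sets (cube_measure n)"
  by (simp_all add: order_stats_def)

lemma AE_order_stats: "AE u in order_stats n. u \<in> open_simplex n"
  unfolding order_stats_def by (subst AE_density) (auto simp: indicator_def)

lemma node_measurable [measurable]:
  "(\<lambda>u. node n u i) \<in> borel_measurable (cube_measure n)"
  by (cases "i = 0 \<or> i > n") (auto simp: node_def[abs_def])

lemma gap_measurable [measurable]:
  "(\<lambda>u. gap n u i) \<in> borel_measurable (cube_measure n)"
  unfolding gap_def[abs_def] by measurable

lemma node_le: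
  assumes "u \<in> open_simplex n" "i \<le> j"
  shows "node n u i \<le> node n u j"
proof (cases "i = j")
  case False
  then show ?thesis using assms unfolding node_def open_simplex_iff
    by (auto simp: less_imp_le)
qed simp

lemma gap_nonneg: "u \<in> open_simplex n \<Longrightarrow> 0 \<le> gap n u i"
  using node_le[of u n "i - 1" i] by (simp add: gap_def)

lemma sum_gap: "a \<le> c \<Longrightarrow> (\<Sum>i\<in>{Suc a..c}. gap n u i) = node n u c - node n u a"
proof (induction c)
  case (Suc c)
  show ?case
  proof (cases "a = Suc c")
    case False
    then show ?thesis using Suc by (simp add: gap_def)
  qed simp
qed simp

lemma ins_pt_in_simplex:
  assumes "q \<in> {1..Suc n}" and "V \<in> extensional {1..n}"
  shows "ins_pt n q y V \<in> open_simplex (Suc n) \<longleftrightarrow>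
    V \<in> open_simplex n \<and> node n V (q - 1) < y \<and> y < node n V q"
proof
  assume L: "ins_pt n q y V \<in> open_simplex (Suc n)"
  let ?u = "ins_pt n q y V"
  have rng: "0 < ?u i \<and> ?u i < 1" if "i \<in> {1..Suc n}" for i
    using L that unfolding open_simplex_iff by blast
  have mono: "?u i < ?u j" if "i < j" "i \<in> {1..Suc n}" "j \<in> {1..Suc n}" for i j
    using L that unfolding open_simplex_iff by blast
  have V: "V i = (if i < q then ?u i else ?u (Suc i))" if "i \<in> {1..n}" for i
    using that by (auto simp: ins_pt_def)
  have y: "?u q = y" using assms by (simp add: ins_pt_def)
  have "V \<in> open_simplex n"
    unfolding open_simplex_iff
  proof (intro conjI ballI impI assms)
    fix i assume i: "i \<in> {1..n}"
    show "0 < V i" "V i < 1" using i rng[of i] rng[of "Suc i"] V[of i] by auto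
    fix j assume j: "j \<in> {1..n}" "i < j"
    then show "V i < V j"
      using i mono[of i j] mono[of i "Suc j"] mono[of "Suc i" "Suc j"] V[of i] V[of j] by auto
  qed
  moreover have "node n V (q - 1) < y"
    using assms rng[of q] mono[of "q - 1" q] V[of "q - 1"] y by (auto simp: node_def)
  moreover have "y < node n V q"
    using assms rng[of q] mono[of q "Suc q"] V[of q] y by (auto simp: node_def)
  ultimately show "V \<in> open_simplex n \<and> node n V (q - 1) < y \<and> y < node n V q" by blast
next
  assume R: "V \<in> open_simplex n \<and> node n V (q - 1) < y \<and> y < node n V q"
  let ?u = "ins_pt n q y V"
  have node_u: "node (Suc n) ?u i = (if i < q then node n V i else if i = q then y else node n V (i - 1))" for i
    using assms by (auto simp: ins_pt_def node_def)
  have lt: "node n V i < node n V j" if "i < j" "j \<le> Suc n" for i j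
    using R that by (auto simp: node_def open_simplex_iff)
  have le: "node n V i \<le> node n V j" if "i \<le> j" for i j
    using R node_le that by blast
  have step: "node (Suc n) ?u i < node (Suc n) ?u j" if "i < j" "j \<le> Suc (Suc n)" for i j
  proof -
    have le_l: "i < q \<Longrightarrow> node n V i \<le> node n V (q - 1)"
      and le_r: "q < j \<Longrightarrow> node n V q \<le> node n V (j - 1)"
      by (auto intro: le)
    consider "j < q" | "i < q" "j = q" | "i < q" "q < j" | "i = q" | "q < i" using that by linarith
    then show ?thesis
      unfolding node_u using that assms R lt[of i j] lt[of i "j - 1"] lt[of "i - 1" "j - 1"]
        le_l le_r
      by cases (auto simp del: One_nat_def intro: le_less_trans less_le_trans)
  qed
  have u: "?u i = node (Suc n) ?u i" if "i \<in> {1..Suc n}" for i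
    using that by (simp add: node_def)
  show "?u \<in> open_simplex (Suc n)"
    unfolding open_simplex_iff
  proof (intro conjI ballI impI)
    show "?u \<in> extensional {1..Suc n}" by (simp add: ins_pt_def)
    fix i assume i: "i \<in> {1..Suc n}"
    show "0 < ?u i" using step[of 0 i] i u by (simp add: node_def)
    show "?u i < 1" using step[of i "Suc (Suc n)"] i u by (simp add: node_def)
    fix j assume "j \<in> {1..Suc n}" "i < j"
    then show "?u i < ?u j" using i u step[of i j] by auto
  qed
qed

lemma del_ins:
  assumes "q \<in> {1..Suc n}" and "V \<in> extensional {1..n}"
  shows "del_pt n q (ins_pt n q y V) = V"
  using assms by (auto simp: del_pt_def ins_pt_def fun_eq_iff extensional_def)

lemma del_pt_measurable [measurable]:
  "del_pt n q \<in> measurable (cube_measure (Suc n))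
     (cube_measure n)"
  unfolding del_pt_def cube_measure_def[of n]
proof (rule measurable_restrict)
  fix i assume "i \<in> {1..n}"
  then show "(\<lambda>x. if i < q then x i else x (Suc i)) \<in> cube_measure (Suc n) \<rightarrow>\<^sub>M lborel"
    by (cases "i < q") auto
qed

lemma ins_pt_measurable:
  assumes "q \<in> {1..Suc n}"
  shows "(\<lambda>(y, V). ins_pt n q y V) \<in> measurable (lborel \<Otimes>\<^sub>M (cube_measure n))
     (cube_measure (Suc n))"
  unfolding ins_pt_def split_def cube_measure_def[of "Suc n"]
proof (rule measurable_restrict)
  fix i assume i: "i \<in> {1..Suc n}"
  have m: "(\<lambda>x. snd x j) \<in> borel_measurable (lborel \<Otimes>\<^sub>M cube_measure n)" if "1 \<le> j" "j \<le> n" for j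
    using measurable_compose[OF measurable_snd measurable_coord[OF that]] .
  show "(\<lambda>x. if i < q then snd x i else if i = q then fst x else snd x (i - 1))
     \<in> lborel \<Otimes>\<^sub>M cube_measure n \<rightarrow>\<^sub>M lborel"
  proof -
    have "1 \<le> i - 1 \<and> i - 1 \<le> n" if "q < i" using assms i that by auto
    then show ?thesis
      using assms i m[of i] m[of "i - 1"] by (cases "i < q"; cases "i = q") (auto simp del: One_nat_def)
  qed
qed

lemma prod_split_at:
  fixes h :: "nat \<Rightarrow> 'a::comm_monoid_mult"
  assumes "q \<in> {1..Suc n}"
  shows "(\<Prod>i\<in>{1..Suc n}. h i) = h q * (\<Prod>i\<in>{1..n}. h (if i < q then i else Suc i))"
proof -
  have "bij_betw (\<lambda>i. if i < q then i else Suc i) {1..n} ({1..Suc n} - {q})"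
    by (rule bij_betw_byWitness[where f' = "\<lambda>i. if i < q then i else i - 1"]) (use assms in auto)
  then have "(\<Prod>i\<in>{1..n}. h (if i < q then i else Suc i)) = (\<Prod>i\<in>{1..Suc n} - {q}. h i)"
    by (rule prod.reindex_bij_betw)
  then show ?thesis using assms by (subst prod.remove[of _ q]) auto
qed

interpretation lborel_product: product_sigma_finite "\<lambda>_::nat. lborel :: real measure"
  by standard

text \<open>
  The insertion only permutes coordinates, and Lebesgue measure on the cube is a product of equal
  factors.
\<close>

lemma distr_ins_pt:
  assumes q: "q \<in> {1..Suc n}"
  shows "distr (lborel \<Otimes>\<^sub>M (cube_measure n)) (cube_measure (Suc n))
      (\<lambda>(y, V). ins_pt n q y V) = (cube_measure (Suc n))"
proof -
  let ?D = "distr (lborel \<Otimes>\<^sub>M cube_measure n) (cube_measure (Suc n)) (\<lambda>(y, V). ins_pt n q y V)"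
  have "?D = (\<Pi>\<^sub>M i\<in>{1..Suc n}. lborel)"
  proof (rule lborel_product.PiM_eqI)
  let ?P = "cube_measure n"
  note [measurable] = ins_pt_measurable[OF q]
  interpret P: sigma_finite_measure ?P
    unfolding cube_measure_def by (rule lborel_product.sigma_finite) simp
  fix A :: "nat \<Rightarrow> real set" assume A: "\<And>i. i \<in> {1..Suc n} \<Longrightarrow> A i \<in> sets lborel"
  let ?\<sigma> = "\<lambda>i. if i < q then i else Suc i"
  have A': "A (?\<sigma> i) \<in> sets lborel" if "i \<in> {1..n}" for i
    using that A[of i] A[of "Suc i"] by auto
  have "(\<lambda>(y, V). ins_pt n q y V) -` (\<Pi>\<^sub>E i\<in>{1..Suc n}. A i) \<inter> space (lborel \<Otimes>\<^sub>M ?P)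
    = A q \<times> (\<Pi>\<^sub>E i\<in>{1..n}. A (?\<sigma> i))" (is "?L = ?R")
  proof (intro equalityI subsetI)
    fix z assume z: "z \<in> ?L"
    obtain y V where yV: "z = (y, V)" by (cases z)
    have V: "V \<in> extensional {1..n}" and mem: "ins_pt n q y V i \<in> A i" if "i \<in> {1..Suc n}" for i
      using z that by (auto simp: yV space_pair_measure space_cube_measure PiE_def)
    have "V i \<in> A (?\<sigma> i)" if "i \<in> {1..n}" for i
      using mem[of "?\<sigma> i"] that q by (auto simp: ins_pt_def split: if_splits)
    moreover have "y \<in> A q" using mem[of q] q by (simp add: ins_pt_def)
    ultimately show "z \<in> ?R" using V[OF q] by (simp add: yV PiE_iff)
  next
    fix z assume z: "z \<in> ?R"
    obtain y V where yV: "z = (y, V)" by (cases z)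
    have V: "V \<in> extensional {1..n}" and y: "y \<in> A q"
      and mem: "\<And>i. i \<in> {1..n} \<Longrightarrow> V i \<in> A (?\<sigma> i)"
      using z unfolding yV by (auto simp: PiE_iff)
    have "ins_pt n q y V i \<in> A i" if i: "i \<in> {1..Suc n}" for i
    proof -
      consider "i < q" | "i = q" | k where "i = Suc k" "q \<le> k"
        by (metis less_imp_Suc_add linorder_neqE_nat le_add1 add_Suc_right)
      then show ?thesis
        using mem[of i] mem[of "i - 1"] i q y by cases (auto simp: ins_pt_def)
    qed
    moreover have "ins_pt n q y V \<in> extensional {1..Suc n}" by (simp add: ins_pt_def)
    ultimately show "z \<in> ?L" using V
      by (simp add: yV space_pair_measure space_cube_measure PiE_iff)
  qed
  note preim = this
  have boxQ: "Pi\<^sub>E {1..Suc n} A \<in> sets (cube_measure (Suc n))"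
    using A unfolding cube_measure_def by (intro sets_PiM_I_finite) auto
  have boxP: "(\<Pi>\<^sub>E i\<in>{1..n}. A (?\<sigma> i)) \<in> sets ?P"
    unfolding cube_measure_def by (rule sets_PiM_I_finite) (use A' in auto)
  have "emeasure ?P (\<Pi>\<^sub>E i\<in>{1..n}. A (?\<sigma> i)) = (\<Prod>i\<in>{1..n}. emeasure lborel (A (?\<sigma> i)))"
    unfolding cube_measure_def by (rule lborel_product.emeasure_PiM) (use A' in auto)
  then have "emeasure (lborel \<Otimes>\<^sub>M ?P) (A q \<times> (\<Pi>\<^sub>E i\<in>{1..n}. A (?\<sigma> i))) = (\<Prod>i\<in>{1..Suc n}. emeasure lborel (A i))"
    using P.emeasure_pair_measure_Times[OF A[OF q] boxP]
    by (simp only: prod_split_at[OF q, of "\<lambda>i. emeasure lborel (A i)"])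
  then show "emeasure (distr (lborel \<Otimes>\<^sub>M ?P) (cube_measure (Suc n)) (\<lambda>(y, V). ins_pt n q y V)) (Pi\<^sub>E {1..Suc n} A)
     = (\<Prod>i\<in>{1..Suc n}. emeasure lborel (A i))"
    by (subst emeasure_distr[OF ins_pt_measurable[OF q] boxQ]) (simp only: preim)
qed (simp_all add: cube_measure_def)
  then show ?thesis by (simp add: cube_measure_def)
qed


text \<open>
  By Fubini the deleted point is integrated over the gap into which it falls. The factor \<open>n + 1\<close> is the
  quotient of the two normalising factorials.
\<close>

lemma distr_del_pt:
  assumes q: "q \<in> {1..Suc n}"
  shows "distr (order_stats (Suc n)) (cube_measure n) (del_pt n q)
    = density (order_stats n) (\<lambda>V. ennreal (real (Suc n) * gap n V q))"
proof (rule measure_eqI)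
  let ?P = "cube_measure n"
  let ?Q = "cube_measure (Suc n)"
  note [measurable] = ins_pt_measurable[OF q]
  interpret P: sigma_finite_measure ?P
    unfolding cube_measure_def by (rule lborel_product.sigma_finite) simp
  interpret PL: pair_sigma_finite lborel ?P ..
  fix A assume "A \<in> sets (distr (order_stats (Suc n)) ?P (del_pt n q))"
  then have A [measurable]: "A \<in> sets ?P" by simp
  let ?h = "\<lambda>u. ennreal (fact (Suc n) * indicator (open_simplex (Suc n)) u) * indicator A (del_pt n q u)"
  have ind: "?h (ins_pt n q y V) = ennreal (fact (Suc n) * indicator (open_simplex n) V) * indicator A V *
      indicator {node n V (q - 1)<..<node n V q} y" if "V \<in> space ?P" for y V
  proof -
    have "V \<in> extensional {1..n}" using that by (simp add: space_cube_measure)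
    then show ?thesis using ins_pt_in_simplex[OF q] del_ins[OF q]
      by (auto simp: indicator_def)
  qed
  have "emeasure (distr (order_stats (Suc n)) ?P (del_pt n q)) A
      = (\<integral>\<^sup>+u. indicator A (del_pt n q u) \<partial>order_stats (Suc n))"
    by (subst nn_integral_indicator[symmetric], simp, subst nn_integral_distr)
       (simp_all add: measurable_cong_sets[OF sets_order_stats refl])
  also have "\<dots> = (\<integral>\<^sup>+u. ?h u \<partial>?Q)"
    unfolding order_stats_def by (subst nn_integral_density) (simp_all add: mult.commute)
  also have "\<dots> = (\<integral>\<^sup>+u. ?h u \<partial>distr (lborel \<Otimes>\<^sub>M ?P) ?Q (\<lambda>(y, V). ins_pt n q y V))"
    by (simp only: distr_ins_pt[OF q])
  also have "\<dots> = (\<integral>\<^sup>+z. ?h (ins_pt n q (fst z) (snd z)) \<partial>(lborel \<Otimes>\<^sub>M ?P))"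
    by (subst nn_integral_distr) (simp_all add: split_def)
  also have "\<dots> = (\<integral>\<^sup>+V. \<integral>\<^sup>+y. ?h (ins_pt n q y V) \<partial>lborel \<partial>?P)"
    by (subst PL.nn_integral_snd[symmetric]) (simp_all add: split_def)
  also have "\<dots> = (\<integral>\<^sup>+V. ennreal (fact (Suc n) * indicator (open_simplex n) V) * indicator A V *
      ennreal (gap n V q) \<partial>?P)"
  proof (rule nn_integral_cong)
    fix V assume V: "V \<in> space ?P"
    show "(\<integral>\<^sup>+y. ?h (ins_pt n q y V) \<partial>lborel) = ennreal (fact (Suc n) * indicator (open_simplex n) V) * indicator A V *
      ennreal (gap n V q)"
    proof (cases "V \<in> open_simplex n")
      case True
      then show ?thesis using node_le[OF True, of "q - 1" q]
        by (simp only: ind[OF V]) (simp add: nn_integral_cmult gap_def)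
    qed (simp only: ind[OF V], simp)
  qed
  also have "\<dots> = (\<integral>\<^sup>+V. ennreal (fact n * indicator (open_simplex n) V) *
      (ennreal (real (Suc n) * gap n V q) * indicator A V) \<partial>?P)"
  proof (rule nn_integral_cong)
    fix V
    have "ennreal (fact (Suc n)) = ennreal (real (Suc n)) * ennreal (fact n)"
      by (subst ennreal_mult[symmetric]) (simp_all add: algebra_simps)
    then show "ennreal (fact (Suc n) * indicator (open_simplex n) V) * indicator A V * ennreal (gap n V q)
       = ennreal (fact n * indicator (open_simplex n) V) * (ennreal (real (Suc n) * gap n V q) * indicator A V)"
      by (cases "V \<in> open_simplex n") (simp_all add: gap_nonneg ennreal_mult mult_ac)
  qed
  also have "\<dots> = emeasure (density (order_stats n) (\<lambda>V. ennreal (real (Suc n) * gap n V q))) A"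
    unfolding order_stats_def
    by (subst emeasure_density, simp, simp, subst nn_integral_density) simp_all
  finally show "emeasure (distr (order_stats (Suc n)) ?P (del_pt n q)) A =
    emeasure (density (order_stats n) (\<lambda>V. ennreal (real (Suc n) * gap n V q))) A" .
qed simp


lemma sum_gap_all: "(\<Sum>i\<in>{1..Suc n}. gap n u i) = 1"
  using sum_gap[of 0 "Suc n" n u] by (simp add: node_def del: sum.cl_ivl_Suc)

section \<open>Moments of the gaps\<close>

text \<open>
  Summing the masses of \<open>distr_del_pt\<close> over all \<open>q\<close> replaces the gaps by their total length \<open>1\<close>, so
  consecutive total masses agree.
\<close>

lemma emeasure_order_stats: "emeasure (order_stats n) (space (order_stats n)) = 1"
proof (induction n)
  case 0
  have "emeasure (cube_measure 0) (space (cube_measure 0)) = 1"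
    using lborel_product.emeasure_PiM[of "{}" "\<lambda>_. UNIV"] by (simp add: cube_measure_def space_PiM)
  moreover have "open_simplex 0 = space (cube_measure 0)"
    by (auto simp: open_simplex_iff space_cube_measure)
  ultimately show ?case
    by (simp add: order_stats_def emeasure_density ennreal_indicator)
next
  case (Suc n)
  let ?e = "emeasure (order_stats (Suc n)) (space (order_stats (Suc n)))"
  have "?e = (\<integral>\<^sup>+V. ennreal (real (Suc n) * gap n V q) \<partial>order_stats n)" if "q \<in> {1..Suc n}" for q
  proof -
    have "?e = emeasure (distr (order_stats (Suc n)) (cube_measure n) (del_pt n q)) (space (cube_measure n))"
      by (subst emeasure_distr)
        (auto simp: measurable_cong_sets[OF sets_order_stats refl] intro!: arg_cong2[where f = emeasure]
          measurable_space[OF del_pt_measurable])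
    also have "\<dots> = (\<integral>\<^sup>+V. ennreal (real (Suc n) * gap n V q) \<partial>order_stats n)"
      unfolding distr_del_pt[OF that]
      by (subst emeasure_density) (auto intro!: nn_integral_cong)
    finally show ?thesis .
  qed
  then have "(\<Sum>q\<in>{1..Suc n}. ?e) = (\<Sum>q\<in>{1..Suc n}. \<integral>\<^sup>+V. ennreal (real (Suc n) * gap n V q) \<partial>order_stats n)"
    by (rule sum.cong[OF refl])
  also have "\<dots> = (\<integral>\<^sup>+V. (\<Sum>q\<in>{1..Suc n}. ennreal (real (Suc n) * gap n V q)) \<partial>order_stats n)"
    by (rule nn_integral_sum[symmetric]) measurable
  also have "\<dots> = (\<integral>\<^sup>+V. ennreal (real (Suc n)) \<partial>order_stats n)"
  proof (rule nn_integral_cong_AE)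
    show "AE V in order_stats n. (\<Sum>q\<in>{1..Suc n}. ennreal (real (Suc n) * gap n V q)) = ennreal (real (Suc n))"
      using AE_order_stats
    proof eventually_elim
      case (elim V)
      have "(\<Sum>q\<in>{1..Suc n}. ennreal (real (Suc n) * gap n V q)) = ennreal (\<Sum>q\<in>{1..Suc n}. real (Suc n) * gap n V q)"
        by (rule sum_ennreal) (use gap_nonneg[OF elim] in auto)
      then show ?case by (simp only: sum_distrib_left[symmetric] sum_gap_all mult_1_right)
    qed
  qed
  also have "\<dots> = ennreal (real (Suc n))"
    using Suc by (simp del: space_order_stats of_nat_Suc)
  finally have "ennreal (real (Suc n)) * ?e = ennreal (real (Suc n)) * 1"
    by (simp add: ennreal_of_nat_eq_real_of_nat del: space_order_stats of_nat_Suc)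
  then show ?case
    by (subst (asm) ennreal_mult_cancel_left) auto
qed

lemma finite_measure_order_stats: "finite_measure (order_stats n)"
  by standard (simp add: emeasure_order_stats del: space_order_stats)

lemma measure_order_stats: "measure (order_stats n) (space (order_stats n)) = 1"
  by (simp add: measure_def emeasure_order_stats del: space_order_stats)

lemma measurable_order_stats_eq [simp]: "measurable (order_stats n) N = measurable (cube_measure n) N"
  by (rule measurable_cong_sets) auto

lemma integrable_order_stats:
  fixes F :: "_ \<Rightarrow> real"
  assumes "F \<in> borel_measurable (cube_measure n)" "\<And>u. u \<in> open_simplex n \<Longrightarrow> \<bar>F u\<bar> \<le> B"
  shows "integrable (order_stats n) F"
proof (rule finite_measure.integrable_const_bound[OF finite_measure_order_stats])
  show "AE u in order_stats n. norm (F u) \<le> B"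
    using AE_order_stats by eventually_elim (use assms in simp)
qed (use assms in simp)

text \<open>
  The form in which the deletion identity is used: taking \<open>F\<close> to be \<open>1\<close>, a gap, or a coordinate of
  a word gives the first moments, the second moments, and the relation between signature
  and insertion.
\<close>

lemma integral_del_pt:
  fixes F :: "_ \<Rightarrow> real"
  assumes q: "q \<in> {1..Suc n}" and F: "F \<in> borel_measurable (cube_measure n)"
  shows "(\<integral>u. F (del_pt n q u) \<partial>order_stats (Suc n)) = (\<integral>u. real (Suc n) * gap n u q * F u \<partial>order_stats n)"
proof -
  have "(\<integral>u. F (del_pt n q u) \<partial>order_stats (Suc n)) = integral\<^sup>L (distr (order_stats (Suc n)) (cube_measure n) (del_pt n q)) F"
    by (rule integral_distr[symmetric]) (use F in auto)
  also have "\<dots> = (\<integral>u. (real (Suc n) * gap n u q) *\<^sub>R F u \<partial>order_stats n)"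
    unfolding distr_del_pt[OF q]
    by (rule integral_density) (use F AE_order_stats[of n] gap_nonneg in \<open>auto elim: eventually_mono\<close>)
  finally show ?thesis by simp
qed

lemma gap_le_1: "u \<in> open_simplex n \<Longrightarrow> gap n u i \<le> 1"
  using node_le[of u n 0 "i - 1"] node_le[of u n i "i + Suc n"] by (simp add: gap_def node_def)

lemma integrable_gap: "integrable (order_stats n) (\<lambda>u. gap n u i)"
  by (rule integrable_order_stats[where B = 1]) (auto simp: gap_nonneg gap_le_1)

lemma integrable_gap_mult: "integrable (order_stats n) (\<lambda>u. gap n u i * gap n u j)"
  by (rule integrable_order_stats[where B = 1]) (auto simp: gap_nonneg gap_le_1 mult_le_one)

lemma expectation_gap:
  assumes "q \<in> {1..Suc n}"
  shows "(\<integral>u. gap n u q \<partial>order_stats n) = 1 / (real n + 1)"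
  using integral_del_pt[OF assms, of "\<lambda>_. 1"] measure_order_stats[of "Suc n"]
  by (simp add: divide_simps mult.commute add.commute)

lemma node_del_pt:
  "q \<in> {1..Suc n} \<Longrightarrow> node n (del_pt n q u) i = (if i < q then node (Suc n) u i else node (Suc n) u (Suc i))"
  by (auto simp: node_def del_pt_def)

text \<open>
  Deleting a point merges the two gaps next to it. This is the source of the extra unit on the
  diagonal of the second moments.
\<close>

lemma gap_del_pt:
  assumes "q \<in> {1..Suc n}" "i \<in> {1..Suc n}"
  shows "gap n (del_pt n q u) i = (if i < q then gap (Suc n) u i
    else if i = q then gap (Suc n) u q + gap (Suc n) u (Suc q) else gap (Suc n) u (Suc i))"
proof -
  consider "i < q" | "i = q" | k where "i = Suc k" "q \<le> k"
    by (metis less_imp_Suc_add linorder_neqE_nat le_add1 add_Suc_right)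
  then show ?thesis
    using assms by cases (auto simp: gap_def node_del_pt)
qed

lemma expectation_gap_mult:
  assumes "q \<in> {1..Suc n}" "i \<in> {1..Suc n}"
  shows "(\<integral>u. gap n u q * gap n u i \<partial>order_stats n) = (1 + of_bool (i = q)) / ((real n + 1) * (real n + 2))"
proof -
  have "real (Suc n) * (\<integral>u. gap n u q * gap n u i \<partial>order_stats n) = (\<integral>u. gap n (del_pt n q u) i \<partial>order_stats (Suc n))"
    using integral_del_pt[OF assms(1), of "\<lambda>u. gap n u i"] by (simp add: mult.assoc del: of_nat_Suc)
  also have "\<dots> = (1 + of_bool (i = q)) / (real n + 2)"
    unfolding gap_del_pt[OF assms] using assms
    by (cases "i < q"; cases "i = q") (auto simp: expectation_gap integrable_gap add.commute)
  finally have "(real n + 1) * (\<integral>u. gap n u q * gap n u i \<partial>order_stats n) = (1 + of_bool (i = q)) / (real n + 2)"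
    by (simp add: add.commute)
  then show ?thesis by (simp add: nonzero_eq_divide_eq ac_simps)
qed

lemma expectation_sum_gap:
  assumes "Q \<subseteq> {1..Suc n}"
  shows "(\<integral>u. (\<Sum>i\<in>Q. gap n u i) \<partial>order_stats n) = real (card Q) / (real n + 1)"
proof -
  have "(\<integral>u. (\<Sum>i\<in>Q. gap n u i) \<partial>order_stats n) = (\<Sum>i\<in>Q. 1 / (real n + 1))"
    using assms by (simp add: integrable_gap expectation_gap subset_iff)
  then show ?thesis by simp
qed

lemma expectation_sum_gap_square:
  assumes "Q \<subseteq> {1..Suc n}"
  shows "(\<integral>u. (\<Sum>i\<in>Q. gap n u i)\<^sup>2 \<partial>order_stats n)
    = real (card Q) * (real (card Q) + 1) / ((real n + 1) * (real n + 2))"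
proof -
  have fin: "finite Q" using assms finite_subset by blast
  have "(\<integral>u. (\<Sum>i\<in>Q. gap n u i)\<^sup>2 \<partial>order_stats n) = (\<Sum>i\<in>Q. \<Sum>j\<in>Q. \<integral>u. gap n u i * gap n u j \<partial>order_stats n)"
    by (simp add: power2_eq_square sum_product integrable_gap_mult)
  also have "\<dots> = (\<Sum>i\<in>Q. \<Sum>j\<in>Q. (1 + of_bool (j = i)) / ((real n + 1) * (real n + 2)))"
    using assms by (intro sum.cong refl expectation_gap_mult) auto
  also have "\<dots> = (\<Sum>i\<in>Q. (real (card Q) + 1) / ((real n + 1) * (real n + 2)))"
    using fin by (intro sum.cong refl) (simp add: sum_divide_distrib[symmetric] sum.distrib of_bool_def)
  finally show ?thesis by simp
qed

lemma expectation_sum_gap_deviation: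
  assumes "Q \<subseteq> {1..Suc n}"
  shows "(\<integral>u. ((\<Sum>i\<in>Q. gap n u i) - a)\<^sup>2 \<partial>order_stats n)
    = real (card Q) * (real (card Q) + 1) / ((real n + 1) * (real n + 2)) - 2 * a * real (card Q) / (real n + 1) + a\<^sup>2"
proof -
  have i1: "integrable (order_stats n) (\<lambda>u. \<Sum>i\<in>Q. gap n u i)"
    by (simp add: integrable_gap)
  have i2: "integrable (order_stats n) (\<lambda>u. (\<Sum>i\<in>Q. gap n u i)\<^sup>2)"
    by (simp add: power2_eq_square sum_product integrable_gap_mult)
  have "(\<integral>u. ((\<Sum>i\<in>Q. gap n u i) - a)\<^sup>2 \<partial>order_stats n)
     = (\<integral>u. (\<Sum>i\<in>Q. gap n u i)\<^sup>2 - 2 * a * (\<Sum>i\<in>Q. gap n u i) + a\<^sup>2 \<partial>order_stats n)"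
    by (rule Bochner_Integration.integral_cong) (auto simp: power2_diff)
  also have "\<dots> = (\<integral>u. (\<Sum>i\<in>Q. gap n u i)\<^sup>2 \<partial>order_stats n) - 2 * a * (\<integral>u. (\<Sum>i\<in>Q. gap n u i) \<partial>order_stats n) + a\<^sup>2"
    using i1 i2 measure_order_stats[of n] finite_measure.integrable_const[OF finite_measure_order_stats[of n], of "a\<^sup>2"]
    by (simp only: Bochner_Integration.integral_add Bochner_Integration.integral_diff
        Bochner_Integration.integrable_diff integrable_mult_right integral_mult_right_zero lebesgue_integral_const)
      simp
  finally show ?thesis
    by (simp add: expectation_sum_gap[OF assms] expectation_sum_gap_square[OF assms])
qed


section \<open>Signatures and insertions as expectations of words\<close>

text \<open>
  Random pure tensors are kept as lists of factors: insertion and deletion act on the list, and the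
  coordinates inherit measurability and the bound \<open>1\<close> from the factors.
\<close>

definition measurable_word :: "'a measure \<Rightarrow> nat \<Rightarrow> ('a \<Rightarrow> (real ^ 'd::finite) list) \<Rightarrow> bool" where
  "measurable_word M k L \<longleftrightarrow>
     (\<forall>\<omega>. length (L \<omega>) = k \<and> (\<forall>v\<in>set (L \<omega>). norm v \<le> 1)) \<and>
     (\<forall>j<k. (\<lambda>\<omega>. L \<omega> ! j) \<in> borel_measurable M)"

lemma measurable_word_append:
  assumes "measurable_word M k L" "measurable_word M l L'"
  shows "measurable_word M (k + l) (\<lambda>\<omega>. L \<omega> @ L' \<omega>)"
proof -
  have "(\<lambda>\<omega>. (L \<omega> @ L' \<omega>) ! j) \<in> borel_measurable M" if "j < k + l" for j
  proof (cases "j < k")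
    case True
    then show ?thesis using assms by (simp add: measurable_word_def nth_append)
  next
    case False
    then have "j - k < l" using that by simp
    then show ?thesis using assms False by (simp add: measurable_word_def nth_append)
  qed
  then show ?thesis using assms by (auto simp: measurable_word_def)
qed

lemma measurable_word_singleton: "norm x \<le> 1 \<Longrightarrow> measurable_word M (Suc 0) (\<lambda>_. [x])"
  by (simp add: measurable_word_def)

lemma measurable_word_map:
  assumes "\<And>i. a \<le> i \<Longrightarrow> i < b \<Longrightarrow> h i \<in> borel_measurable M" "\<And>i \<omega>. norm (h i \<omega>) \<le> 1"
  shows "measurable_word M (b - a) (\<lambda>\<omega>. map (\<lambda>i. h i \<omega>) [a..<b])"
  using assms by (auto simp: measurable_word_def)

lemma measurable_word_compose:
  assumes "measurable_word N k L" "T \<in> measurable M N"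
  shows "measurable_word M k (\<lambda>\<omega>. L (T \<omega>))"
  using assms by (auto simp: measurable_word_def intro: measurable_compose)

lemma measurable_word_conv_map:
  "measurable_word M k L \<Longrightarrow> map (\<lambda>j. L \<omega> ! j) [0..<k] = L \<omega>"
  using map_nth[of "L \<omega>"] by (simp add: measurable_word_def)

lemma pure_tensor_measurable_word:
  assumes "measurable_word M k L"
  shows "(\<lambda>\<omega>. pure_tensor (L \<omega>) is) \<in> borel_measurable M"
  using pure_tensor_map_measurable[of k "\<lambda>j \<omega>. L \<omega> ! j" M "is"] assms
  by (simp add: measurable_word_conv_map[OF assms]) (simp add: measurable_word_def)

lemma projective_norm_integral_word_le:
  assumes L: "measurable_word M k L" and "0 < k" "integrable M w"
  shows "projective_norm k (\<lambda>is. \<integral>\<omega>. w \<omega> * pure_tensor (L \<omega>) is \<partial>M) \<le> (\<integral>\<omega>. \<bar>w \<omega>\<bar> \<partial>M)"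
proof -
  have "norm (L \<omega> ! j) \<le> 1" if "j < k" for j \<omega>
    using L that nth_mem[of j "L \<omega>"] by (auto simp: measurable_word_def simp del: nth_mem)
  then show ?thesis
    using projective_norm_integral_le[of k "\<lambda>j \<omega>. L \<omega> ! j" M w] assms
    by (simp add: measurable_word_conv_map[OF L]) (simp add: measurable_word_def)
qed

lemma abs_pure_tensor_word_le_1: "measurable_word M k L \<Longrightarrow> \<bar>pure_tensor (L \<omega>) is\<bar> \<le> 1"
  by (rule abs_pure_tensor_le_1) (auto simp: measurable_word_def)

lemma integrable_mult_word:
  assumes L: "measurable_word M k L" and w: "integrable M w"
  shows "integrable M (\<lambda>\<omega>. w \<omega> * pure_tensor (L \<omega>) is)"
proof (rule Bochner_Integration.integrable_bound[OF w])
  show "AE \<omega> in M. norm (w \<omega> * pure_tensor (L \<omega>) is) \<le> norm (w \<omega>)"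
    using abs_pure_tensor_word_le_1[OF L] by (simp add: abs_mult mult_left_le)
qed (use pure_tensor_measurable_word[OF L] w in simp)

lemma of_order_integral_word:
  "measurable_word M k L \<Longrightarrow> of_order k (\<lambda>is. \<integral>\<omega>. w \<omega> * pure_tensor (L \<omega>) is \<partial>M)"
  by (auto simp: of_order_def measurable_word_def pure_tensor_def)

lemma integrable_const_order_stats: "integrable (order_stats n) (\<lambda>_. a :: real)"
  by (rule finite_measure.integrable_const[OF finite_measure_order_stats])

lemma integral_const_order_stats: "(\<integral>u. (a :: real) \<partial>order_stats n) = a"
  using measure_order_stats[of n] by simp

text \<open>
  The integrand \<open>F\<close> is only compared with \<open>G\<close> on the simplex, because \<open>f\<close> is arbitrary outside \<open>(0, 1)\<close>;
  measurability is available for the extension \<open>G\<close>.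
\<close>

lemma simplex_integral_eq_order_stats:
  fixes F :: "(nat \<Rightarrow> real) \<Rightarrow> 'd tensor"
  assumes "G \<in> borel_measurable (cube_measure n)" "\<And>u. u \<in> open_simplex n \<Longrightarrow> F u is = G u"
  shows "fact n * simplex_integral n F is = (\<integral>u. G u \<partial>order_stats n)"
proof -
  have "(\<integral>u. G u \<partial>order_stats n) = (\<integral>u. (fact n * indicator (open_simplex n) u) *\<^sub>R G u \<partial>cube_measure n)"
    unfolding order_stats_def by (rule integral_density) (use assms in auto)
  also have "\<dots> = fact n * (\<integral>u. indicator (open_simplex n) u *\<^sub>R G u \<partial>cube_measure n)"
    by (simp add: mult.assoc)
  also have "(\<integral>u. indicator (open_simplex n) u *\<^sub>R G u \<partial>cube_measure n)
     = (\<integral>u. indicator (open_simplex n) u *\<^sub>R F u is \<partial>cube_measure n)"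
    by (rule Bochner_Integration.integral_cong) (auto simp: indicator_def assms)
  finally show ?thesis
    by (simp add: simplex_integral_def set_lebesgue_integral_def cube_measure_def)
qed

definition ins_word :: "(real \<Rightarrow> 'a) \<Rightarrow> nat \<Rightarrow> nat \<Rightarrow> 'a \<Rightarrow> (nat \<Rightarrow> real) \<Rightarrow> 'a list" where
  "ins_word g p n x u = map (\<lambda>i. g (u i)) [1..<p] @ [x] @ map (\<lambda>i. g (u i)) [p..<Suc n]"

definition path_word :: "(real \<Rightarrow> 'a) \<Rightarrow> nat \<Rightarrow> (nat \<Rightarrow> real) \<Rightarrow> 'a list" where
  "path_word g n u = map (\<lambda>i. g (u i)) [1..<Suc n]"

lemma measurable_path_segment:
  fixes g :: "real \<Rightarrow> real ^ 'd::finite"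
  assumes g: "g \<in> borel_measurable borel" "\<And>r. norm (g r) \<le> 1" and "1 \<le> a" "b \<le> Suc n"
  shows "measurable_word (cube_measure n) (b - a) (\<lambda>u. map (\<lambda>i. g (u i)) [a..<b])"
  by (rule measurable_word_map) (use assms in \<open>auto intro: measurable_compose[OF measurable_coord]\<close>)

lemma measurable_path_word:
  fixes g :: "real \<Rightarrow> real ^ 'd::finite"
  assumes g: "g \<in> borel_measurable borel" "\<And>r. norm (g r) \<le> 1"
  shows "measurable_word (cube_measure n) n (path_word g n)"
  using measurable_path_segment[OF g, of 1 "Suc n" n] by (simp add: path_word_def[abs_def])

lemma measurable_ins_word:
  fixes g :: "real \<Rightarrow> real ^ 'd::finite"
  assumes g: "g \<in> borel_measurable borel" "\<And>r. norm (g r) \<le> 1"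
    and p: "p \<in> {1..Suc n}" and x: "norm x \<le> 1"
  shows "measurable_word (cube_measure n) (Suc n) (ins_word g p n x)"
proof -
  have "measurable_word (cube_measure n) ((p - 1) + (Suc 0 + (Suc n - p))) (ins_word g p n x)"
    unfolding ins_word_def[abs_def]
    by (intro measurable_word_append measurable_word_singleton measurable_path_segment)
      (use assms in auto)
  then show ?thesis using p by simp
qed

lemma measurable_word_order_stats [simp]:
  "measurable_word (order_stats n) k L = measurable_word (cube_measure n) k L"
  by (simp add: measurable_word_def)

lemma length_ins_word: "p \<in> {1..Suc n} \<Longrightarrow> length (ins_word g p n x u) = Suc n"
  by (simp add: ins_word_def)

lemma nth_ins_word:
  assumes "p \<in> {1..Suc n}" "i \<in> {1..Suc n}"
  shows "ins_word g p n x u ! (i - 1) = (if i < p then g (u i) else if i = p then x else g (u (i - 1)))"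
  using assms by (auto simp: ins_word_def nth_append nth_Cons' simp del: upt_Suc)

section \<open>Approximating the signature by an insertion\<close>

text \<open>
  All factors with index between \<open>p\<close> and \<open>q\<close> equal \<open>b\<close>. Removing the one at \<open>q\<close> and adding one at \<open>p\<close>
  therefore leaves the word unchanged.
\<close>

lemma ins_word_del_pt:
  assumes pq: "1 \<le> p" "p \<le> q" "q \<le> Suc n"
    and u: "u \<in> open_simplex (Suc n)" and st: "s < u p" "u q < t"
    and b: "\<And>r. s < r \<Longrightarrow> r < t \<Longrightarrow> g r = b"
  shows "ins_word g p n b (del_pt n q u) = path_word g (Suc n) u"
proof (rule nth_equalityI)
  show "length (ins_word g p n b (del_pt n q u)) = length (path_word g (Suc n) u)"
    using pq by (simp add: length_ins_word path_word_def)
  have mono: "u i \<le> u j" if "1 \<le> i" "i \<le> j" "j \<le> Suc n" for i j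
    using u that by (cases "i = j") (auto simp: open_simplex_iff less_imp_le)
  fix j assume "j < length (ins_word g p n b (del_pt n q u))"
  then have j: "Suc j \<in> {1..Suc n}" using pq by (simp add: length_ins_word)
  have mid: "g (u i) = b" if "p \<le> i" "i \<le> q" for i
    by (rule b) (use mono[of p i] mono[of i q] that pq st in auto)
  have "ins_word g p n b (del_pt n q u) ! j = g (u (Suc j))"
    using nth_ins_word[of p n "Suc j" g b "del_pt n q u"] j pq mid
    by (auto simp: del_pt_def)
  also have "\<dots> = path_word g (Suc n) u ! j"
    using j by (simp add: path_word_def del: upt_Suc)
  finally show "ins_word g p n b (del_pt n q u) ! j = path_word g (Suc n) u ! j" .
qed

lemma projective_norm_sum_le:
  assumes "finite Q" "\<And>q. q \<in> Q \<Longrightarrow> of_order k (T q)" "0 < k"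
  shows "projective_norm k (\<lambda>is. \<Sum>q\<in>Q. T q is) \<le> (\<Sum>q\<in>Q. projective_norm k (T q))"
  using assms(1,2)
proof (induction Q rule: finite_induct)
  case empty
  then show ?case using projective_norm_le_cost[OF tensor_cost_zero] by simp
next
  case (insert q Q)
  have "projective_norm k (\<lambda>is. T q is + (\<Sum>q\<in>Q. T q is)) \<le> projective_norm k (T q) + projective_norm k (\<lambda>is. \<Sum>q\<in>Q. T q is)"
    by (rule projective_norm_triangle) (use insert.prems assms(3) in \<open>auto simp: of_order_def\<close>)
  then show ?case using insert by simp
qed

lemma integrable_coord: "q \<in> {1..n} \<Longrightarrow> integrable (order_stats n) (\<lambda>u. (u q - a)\<^sup>2)"
proof (rule integrable_order_stats[where B = "(1 + \<bar>a\<bar>)\<^sup>2"])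
  fix u assume "q \<in> {1..n}" "u \<in> open_simplex n"
  then have "0 < u q" "u q < 1" by (auto simp: open_simplex_iff)
  then have "\<bar>u q - a\<bar> \<le> 1 + \<bar>a\<bar>" by (auto simp: abs_if)
  then have "\<bar>u q - a\<bar>\<^sup>2 \<le> (1 + \<bar>a\<bar>)\<^sup>2" by (rule power_mono) simp
  then show "\<bar>(u q - a)\<^sup>2\<bar> \<le> (1 + \<bar>a\<bar>)\<^sup>2" by simp
qed auto

definition coord_dev :: "nat \<Rightarrow> real \<Rightarrow> nat \<Rightarrow> real" where
  "coord_dev n a q = (\<integral>u. (u q - a)\<^sup>2 \<partial>order_stats n)"

lemma coord_dev_eq:
  assumes "q \<in> {1..n}"
  shows "coord_dev n a q = (real q / (real n + 1)) * ((real q + 1) / (real n + 2)) - 2 * a * (real q / (real n + 1)) + a\<^sup>2"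
proof -
  have "u q = (\<Sum>i\<in>{1..q}. gap n u i)" for u
    using sum_gap[of 0 q n u] assms by (simp add: node_def del: sum.cl_ivl_Suc)
  then show ?thesis
    unfolding coord_dev_def using expectation_sum_gap_deviation[of "{1..q}" n a] assms
    by simp
qed

text \<open>
  By the deletion identity both terms are expectations over the same \<open>n + 1\<close> points, and by
  \<open>ins_word_del_pt\<close> the two words agree when \<open>U p\<close> and \<open>U q\<close> lie in \<open>(s, t)\<close>. The probability of the
  complementary event is bounded by Chebyshev's inequality.
\<close>

lemma shift_comparison:
  fixes g :: "real \<Rightarrow> real ^ 'd::finite"
  assumes g: "g \<in> borel_measurable borel" "\<And>r. norm (g r) \<le> 1" and b1: "norm b \<le> 1"
    and b: "\<And>r. s < r \<Longrightarrow> r < t \<Longrightarrow> g r = b" and \<theta>: "s < \<theta>" "\<theta> < t"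
    and pq: "1 \<le> p" "p \<le> q" "q \<le> Suc n" and a: "0 \<le> a" and \<eta>: "\<eta> = min (\<theta> - s) (t - \<theta>)"
  shows "projective_norm (Suc n) (\<lambda>is. a * ((\<integral>u. real (Suc n) * gap n u q * pure_tensor (ins_word g p n b u) is \<partial>order_stats n)
      - (\<integral>u. pure_tensor (path_word g (Suc n) u) is \<partial>order_stats (Suc n))))
    \<le> 2 * a * (coord_dev (Suc n) \<theta> p + coord_dev (Suc n) \<theta> q) / \<eta>\<^sup>2"
proof -
  let ?O = "order_stats (Suc n)"
  \<comment> \<open>The weight may vanish where both points lie in \<open>(s, t)\<close>, since the two words agree there.\<close>
  define w where "w u = (if s < u p \<and> u q < t then 0 else a)" for u :: "nat \<Rightarrow> real"
  have q: "q \<in> {1..Suc n}" and p: "p \<in> {1..Suc n}" using pq by auto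
  have [measurable]: "(\<lambda>u. u p) \<in> borel_measurable (cube_measure (Suc n))"
    "(\<lambda>u. u q) \<in> borel_measurable (cube_measure (Suc n))" using pq by auto
  have wm: "w \<in> borel_measurable (cube_measure (Suc n))"
    unfolding w_def[abs_def] by measurable
  have wi: "integrable ?O w"
    by (rule integrable_order_stats[OF wm, of a]) (use a in \<open>auto simp: w_def\<close>)
  have W: "measurable_word ?O (Suc n) (path_word g (Suc n))"
    by (simp add: measurable_path_word[OF g])
  have W': "measurable_word ?O (Suc n) (\<lambda>u. ins_word g p n b (del_pt n q u))"
    using measurable_word_compose[OF measurable_ins_word[OF g p b1] del_pt_measurable[of n q]] by simp
  have int1: "integrable ?O (\<lambda>u. pure_tensor (path_word g (Suc n) u) is)"
    and int2: "integrable ?O (\<lambda>u. pure_tensor (ins_word g p n b (del_pt n q u)) is)" for "is"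
    using integrable_mult_word[OF W integrable_const_order_stats, of 1]
      integrable_mult_word[OF W' integrable_const_order_stats, of 1] by simp_all
  have split: "a * ((\<integral>u. real (Suc n) * gap n u q * pure_tensor (ins_word g p n b u) is \<partial>order_stats n)
      - (\<integral>u. pure_tensor (path_word g (Suc n) u) is \<partial>?O))
    = (\<integral>u. w u * pure_tensor (ins_word g p n b (del_pt n q u)) is \<partial>?O)
      + (\<integral>u. - w u * pure_tensor (path_word g (Suc n) u) is \<partial>?O)" for "is"
  proof -
    have "(\<integral>u. real (Suc n) * gap n u q * pure_tensor (ins_word g p n b u) is \<partial>order_stats n)
       = (\<integral>u. pure_tensor (ins_word g p n b (del_pt n q u)) is \<partial>?O)"
      by (rule integral_del_pt[OF q, symmetric])
        (rule pure_tensor_measurable_word[OF measurable_ins_word[OF g p b1]])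
    then have "a * ((\<integral>u. real (Suc n) * gap n u q * pure_tensor (ins_word g p n b u) is \<partial>order_stats n)
      - (\<integral>u. pure_tensor (path_word g (Suc n) u) is \<partial>?O))
      = (\<integral>u. a * (pure_tensor (ins_word g p n b (del_pt n q u)) is - pure_tensor (path_word g (Suc n) u) is) \<partial>?O)"
      using int1 int2 by simp
    also have "\<dots> = (\<integral>u. w u * pure_tensor (ins_word g p n b (del_pt n q u)) is + - w u * pure_tensor (path_word g (Suc n) u) is \<partial>?O)"
    proof (rule integral_cong_AE)
      show "AE u in ?O. a * (pure_tensor (ins_word g p n b (del_pt n q u)) is - pure_tensor (path_word g (Suc n) u) is)
        = w u * pure_tensor (ins_word g p n b (del_pt n q u)) is + - w u * pure_tensor (path_word g (Suc n) u) is"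
        using AE_order_stats
      proof eventually_elim
        case (elim u)
        show ?case
        proof (cases "s < u p \<and> u q < t")
          case True
          then show ?thesis using ins_word_del_pt[OF pq elim, where s = s and t = t and g = g and b = b] b by (auto simp: w_def)
        qed (auto simp: w_def algebra_simps)
      qed
    qed (use wm pure_tensor_measurable_word[OF W] pure_tensor_measurable_word[OF W'] in auto)
    also have "\<dots> = (\<integral>u. w u * pure_tensor (ins_word g p n b (del_pt n q u)) is \<partial>?O)
      + (\<integral>u. - w u * pure_tensor (path_word g (Suc n) u) is \<partial>?O)"
      by (rule Bochner_Integration.integral_add) (intro integrable_mult_word[OF W'] integrable_mult_word[OF W] wi
          Bochner_Integration.integrable_minus)+
    finally show ?thesis .
  qed
  have w0: "0 \<le> w u" for u using a by (simp add: w_def)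
  have "projective_norm (Suc n) (\<lambda>is. (\<integral>u. w u * pure_tensor (ins_word g p n b (del_pt n q u)) is \<partial>?O)
      + (\<integral>u. - w u * pure_tensor (path_word g (Suc n) u) is \<partial>?O))
    \<le> projective_norm (Suc n) (\<lambda>is. \<integral>u. w u * pure_tensor (ins_word g p n b (del_pt n q u)) is \<partial>?O)
      + projective_norm (Suc n) (\<lambda>is. \<integral>u. - w u * pure_tensor (path_word g (Suc n) u) is \<partial>?O)"
    by (rule projective_norm_triangle[OF of_order_integral_word[OF W'] of_order_integral_word[OF W]]) simp
  also have "\<dots> \<le> (\<integral>u. \<bar>w u\<bar> \<partial>?O) + (\<integral>u. \<bar>- w u\<bar> \<partial>?O)"
    by (intro add_mono projective_norm_integral_word_le[OF W'] projective_norm_integral_word_le[OF W]) (use wi in auto)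
  also have "\<dots> = 2 * (\<integral>u. w u \<partial>?O)" using w0 by simp
  also have "(\<integral>u. w u \<partial>?O) \<le> (\<integral>u. a / \<eta>\<^sup>2 * ((u p - \<theta>)\<^sup>2 + (u q - \<theta>)\<^sup>2) \<partial>?O)"
  proof (rule integral_mono)
    show "integrable ?O (\<lambda>u. a / \<eta>\<^sup>2 * ((u p - \<theta>)\<^sup>2 + (u q - \<theta>)\<^sup>2))"
      using integrable_coord[OF p] integrable_coord[OF q] by simp
    have \<eta>0: "0 < \<eta>" using \<theta> \<eta> by simp
    fix u
    show "w u \<le> a / \<eta>\<^sup>2 * ((u p - \<theta>)\<^sup>2 + (u q - \<theta>)\<^sup>2)"
    proof (cases "s < u p \<and> u q < t")
      case True
      then show ?thesis using a by (simp add: w_def)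
    next
      case False
      then have "\<eta> \<le> \<bar>u p - \<theta>\<bar> \<or> \<eta> \<le> \<bar>u q - \<theta>\<bar>" using \<theta> \<eta> by (auto simp: min_def)
      then have "\<eta>\<^sup>2 \<le> (u p - \<theta>)\<^sup>2 \<or> \<eta>\<^sup>2 \<le> (u q - \<theta>)\<^sup>2"
        using \<eta>0 by (metis abs_le_square_iff abs_of_pos)
      then have "\<eta>\<^sup>2 \<le> (u p - \<theta>)\<^sup>2 + (u q - \<theta>)\<^sup>2"
        using zero_le_power2[of "u p - \<theta>"] zero_le_power2[of "u q - \<theta>"] by linarith
      then have "a * \<eta>\<^sup>2 \<le> a * ((u p - \<theta>)\<^sup>2 + (u q - \<theta>)\<^sup>2)" using a by (rule mult_left_mono)
      then have "a \<le> a / \<eta>\<^sup>2 * ((u p - \<theta>)\<^sup>2 + (u q - \<theta>)\<^sup>2)" using \<eta>0 by (simp add: field_simps)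
      then show ?thesis using False by (auto simp: w_def)
    qed
  qed (rule wi)
  also have "(\<integral>u. a / \<eta>\<^sup>2 * ((u p - \<theta>)\<^sup>2 + (u q - \<theta>)\<^sup>2) \<partial>?O) = a / \<eta>\<^sup>2 * (coord_dev (Suc n) \<theta> p + coord_dev (Suc n) \<theta> q)"
    using integrable_coord[OF p] integrable_coord[OF q] by (simp add: coord_dev_def)
  finally show ?thesis unfolding split by simp
qed

text \<open>
  The variance of the normalised sum of \<open>m\<close> gaps is at most \<open>1 / m\<close>, since distinct gaps are
  negatively correlated.
\<close>

lemma gap_average_deviation:
  assumes Q: "Q \<subseteq> {1..Suc n}" and m: "0 < card Q"
  shows "(\<integral>u. \<bar>1 - (real n + 1) / real (card Q) * (\<Sum>q\<in>Q. gap n u q)\<bar> \<partial>order_stats n) \<le> 1 / sqrt (real (card Q))"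
proof -
  define m where "m = real (card Q)"
  define N where "N = real n + 1"
  have m0: "0 < m" and N0: "0 < N" using m by (auto simp: m_def N_def)
  let ?X = "\<lambda>u. 1 - N / m * (\<Sum>q\<in>Q. gap n u q)"
  have X: "?X u = - (N / m) * ((\<Sum>q\<in>Q. gap n u q) - m / N)" for u
    using m0 N0 by (simp add: field_simps)
  have i1: "integrable (order_stats n) (\<lambda>u. \<Sum>i\<in>Q. gap n u i)"
    by (simp add: integrable_gap)
  have i2: "integrable (order_stats n) (\<lambda>u. (\<Sum>i\<in>Q. gap n u i)\<^sup>2)"
    by (simp add: power2_eq_square sum_product integrable_gap_mult)
  have iX: "integrable (order_stats n) ?X" using i1 integrable_const_order_stats by auto
  have "integrable (order_stats n) (\<lambda>u. 1 - 2 * (N / m) * (\<Sum>q\<in>Q. gap n u q) + (N / m)\<^sup>2 * (\<Sum>i\<in>Q. gap n u i)\<^sup>2)"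
    by (intro Bochner_Integration.integrable_add Bochner_Integration.integrable_diff integrable_mult_right i1 i2 integrable_const_order_stats)
  then have iX2: "integrable (order_stats n) (\<lambda>u. (?X u)\<^sup>2)"
    by (simp add: power2_diff power_mult_distrib power_divide algebra_simps)
  have "(\<integral>u. (?X u)\<^sup>2 \<partial>order_stats n) = (N / m)\<^sup>2 * (\<integral>u. ((\<Sum>q\<in>Q. gap n u q) - m / N)\<^sup>2 \<partial>order_stats n)"
    unfolding X by (simp only: power_mult_distrib integral_mult_right_zero power2_minus)
  also have "\<dots> = (N / m)\<^sup>2 * (m * (m + 1) / (N * (N + 1)) - 2 * (m / N) * m / N + (m / N)\<^sup>2)"
    unfolding expectation_sum_gap_deviation[OF Q] by (simp add: m_def N_def add.assoc)
  also have "\<dots> = (N / m)\<^sup>2 * (m * (m + 1) / (N * (N + 1))) - (N / m * (m / N))\<^sup>2"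
    by (simp add: algebra_simps power2_eq_square)
  also have "(N / m)\<^sup>2 * (m * (m + 1) / (N * (N + 1))) = N * (m + 1) / (m * (N + 1))"
    using m0 N0 by (simp add: power2_eq_square)
  also have "(N / m * (m / N))\<^sup>2 = 1"
    using m0 N0 by simp
  also have "N * (m + 1) / (m * (N + 1)) - 1 \<le> 1 / m"
  proof -
    have "N * (m + 1) \<le> (N + 1) * (m + 1)" using m0 by simp
    also have "\<dots> = (1 / m + 1) * (m * (N + 1))" using m0 by (simp add: algebra_simps)
    finally have "N * (m + 1) / (m * (N + 1)) \<le> 1 / m + 1"
      using m0 N0 by (simp only: pos_divide_le_eq mult_pos_pos)
    then show ?thesis by simp
  qed
  finally have V: "(\<integral>u. (?X u)\<^sup>2 \<partial>order_stats n) \<le> 1 / m" .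
  have "(\<integral>u. \<bar>?X u\<bar> \<partial>order_stats n) \<le> (\<integral>u. 1 / (2 * sqrt m) + sqrt m / 2 * (?X u)\<^sup>2 \<partial>order_stats n)"
  proof (rule integral_mono)
    fix u
    \<comment> \<open>Weighted AM-GM; the weight balances the two terms when the second moment is \<open>1 / m\<close>.\<close>
    have "0 \<le> (sqrt m * \<bar>?X u\<bar> - 1)\<^sup>2" by simp
    also have "\<dots> = m * (?X u)\<^sup>2 - 2 * sqrt m * \<bar>?X u\<bar> + 1"
      using m0 by (simp only: power2_diff power_mult_distrib power2_abs real_sqrt_pow2) simp
    finally have "2 * sqrt m * \<bar>?X u\<bar> \<le> 1 + m * (?X u)\<^sup>2" by simp
    then have "\<bar>?X u\<bar> \<le> (1 + m * (?X u)\<^sup>2) / (2 * sqrt m)"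
      using m0 by (simp add: pos_le_divide_eq mult.commute)
    also have "\<dots> = 1 / (2 * sqrt m) + m / (2 * sqrt m) * (?X u)\<^sup>2"
      by (simp add: add_divide_distrib)
    also have "m / (2 * sqrt m) = sqrt m / 2"
      using m0 by (simp add: field_simps)
    finally show "\<bar>?X u\<bar> \<le> 1 / (2 * sqrt m) + sqrt m / 2 * (?X u)\<^sup>2" .
  qed (use iX iX2 integrable_const_order_stats in auto)
  also have "\<dots> = 1 / (2 * sqrt m) + sqrt m / 2 * (\<integral>u. (?X u)\<^sup>2 \<partial>order_stats n)"
    using iX2 integrable_const_order_stats integral_const_order_stats
    by (subst Bochner_Integration.integral_add) (simp_all del: lebesgue_integral_const)
  also have "\<dots> \<le> 1 / (2 * sqrt m) + sqrt m / 2 * (1 / m)"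
    using V m0 by (intro add_left_mono mult_left_mono) auto
  also have "\<dots> = 1 / sqrt m"
    using m0 by (simp add: field_simps)
  finally show ?thesis by (simp add: m_def N_def)
qed


text \<open>
  With \<open>X = 1 - (n + 1) / m * (gap p + \<dots> + gap (p + m - 1))\<close>, the difference is the expectation of \<open>X\<close> times
  the inserted word plus the average over the \<open>m\<close> values of \<open>q\<close> of the differences bounded in
  \<open>shift_comparison\<close>.
\<close>

lemma insertion_error_le:
  fixes g :: "real \<Rightarrow> real ^ 'd::finite"
  assumes g: "g \<in> borel_measurable borel" "\<And>r. norm (g r) \<le> 1" and b1: "norm b \<le> 1"
    and b: "\<And>r. s < r \<Longrightarrow> r < t \<Longrightarrow> g r = b" and \<theta>: "s < \<theta>" "\<theta> < t"
    and pm: "1 \<le> p" "0 < m" "p + m \<le> Suc (Suc n)" and \<eta>: "\<eta> = min (\<theta> - s) (t - \<theta>)"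
  shows "projective_norm (Suc n) (\<lambda>is. (\<integral>u. pure_tensor (ins_word g p n b u) is \<partial>order_stats n)
      - (\<integral>u. pure_tensor (path_word g (Suc n) u) is \<partial>order_stats (Suc n)))
    \<le> 1 / sqrt (real m)
      + (\<Sum>j<m. 2 / real m * (coord_dev (Suc n) \<theta> p + coord_dev (Suc n) \<theta> (p + j)) / \<eta>\<^sup>2)"
proof -
  let ?O = "order_stats n"
  let ?I = "\<lambda>is u. pure_tensor (ins_word g p n b u) is"
  let ?S = "\<lambda>is. \<integral>u. pure_tensor (path_word g (Suc n) u) is \<partial>order_stats (Suc n)"
  let ?Q = "{p..<p + m}"
  define X where "X u = 1 - (real n + 1) / real m * (\<Sum>q\<in>?Q. gap n u q)" for u
  define D where "D q is = 1 / real m * ((\<integral>u. real (Suc n) * gap n u q * ?I is u \<partial>?O) - ?S is)" for q "is"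
  have p: "p \<in> {1..Suc n}" and Q: "?Q \<subseteq> {1..Suc n}" using pm by auto
  have W: "measurable_word ?O (Suc n) (ins_word g p n b)"
    by (simp add: measurable_ins_word[OF g p b1])
  have W': "measurable_word (order_stats (Suc n)) (Suc n) (path_word g (Suc n))"
    by (simp add: measurable_path_word[OF g])
  have iX: "integrable ?O X"
    unfolding X_def using integrable_const_order_stats by (auto simp: integrable_gap)
  have igI: "integrable ?O (\<lambda>u. gap n u q * ?I is u)" for q "is"
    by (rule integrable_mult_word[OF W integrable_gap])
  have iI: "integrable ?O (?I is)" for "is"
    using integrable_mult_word[OF W integrable_const_order_stats, of 1] by simp
  have D0: "of_order (Suc n) (D q)" for q
    using of_order_integral_word[OF W, of "\<lambda>u. real (Suc n) * gap n u q"] of_order_integral_word[OF W', of "\<lambda>_. 1"]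
    by (auto simp: of_order_def D_def)
  have R0: "of_order (Suc n) (\<lambda>is. \<integral>u. X u * ?I is u \<partial>?O)"
    by (rule of_order_integral_word[OF W])
  have split: "(\<integral>u. ?I is u \<partial>?O) - ?S is = (\<integral>u. X u * ?I is u \<partial>?O) + (\<Sum>q\<in>?Q. D q is)" for "is"
  proof -
    have "(\<integral>u. X u * ?I is u \<partial>?O) = (\<integral>u. ?I is u - (real n + 1) / real m * (\<Sum>q\<in>?Q. gap n u q * ?I is u) \<partial>?O)"
      by (rule Bochner_Integration.integral_cong) (simp_all only: X_def left_diff_distrib mult_1_left mult.assoc sum_distrib_right)
    also have "\<dots> = (\<integral>u. ?I is u \<partial>?O) - (real n + 1) / real m * (\<Sum>q\<in>?Q. \<integral>u. gap n u q * ?I is u \<partial>?O)"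
      using igI iI by simp
    finally have X: "(\<integral>u. X u * ?I is u \<partial>?O)
      = (\<integral>u. ?I is u \<partial>?O) - (real n + 1) / real m * (\<Sum>q\<in>?Q. \<integral>u. gap n u q * ?I is u \<partial>?O)" .
    have "(\<Sum>q\<in>?Q. D q is) = 1 / real m * (\<Sum>q\<in>?Q. real (Suc n) * (\<integral>u. gap n u q * ?I is u \<partial>?O) - ?S is)"
      by (simp add: D_def sum_distrib_left mult.assoc)
    also have "\<dots> = 1 / real m * (real (Suc n) * (\<Sum>q\<in>?Q. \<integral>u. gap n u q * ?I is u \<partial>?O) - real m * ?S is)"
      by (simp only: sum_subtractf sum_distrib_left) simp
    also have "\<dots> = (real n + 1) / real m * (\<Sum>q\<in>?Q. \<integral>u. gap n u q * ?I is u \<partial>?O) - ?S is"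
      using pm by (simp add: right_diff_distrib add.commute)
    finally show ?thesis using X by simp
  qed
  have "projective_norm (Suc n) (\<lambda>is. (\<integral>u. X u * ?I is u \<partial>?O) + (\<Sum>q\<in>?Q. D q is))
    \<le> projective_norm (Suc n) (\<lambda>is. \<integral>u. X u * ?I is u \<partial>?O) + projective_norm (Suc n) (\<lambda>is. \<Sum>q\<in>?Q. D q is)"
    by (rule projective_norm_triangle[OF R0]) (use D0 in \<open>auto simp: of_order_def\<close>)
  also have "\<dots> \<le> (\<integral>u. \<bar>X u\<bar> \<partial>?O) + (\<Sum>q\<in>?Q. projective_norm (Suc n) (D q))"
    by (intro add_mono projective_norm_integral_word_le[OF W _ iX] projective_norm_sum_le D0) auto
  also have "\<dots> \<le> 1 / sqrt (real m) + (\<Sum>q\<in>?Q. 2 * (1 / real m) * (coord_dev (Suc n) \<theta> p + coord_dev (Suc n) \<theta> q) / \<eta>\<^sup>2)"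
  proof (intro add_mono sum_mono)
    show "(\<integral>u. \<bar>X u\<bar> \<partial>?O) \<le> 1 / sqrt (real m)"
      using gap_average_deviation[OF Q] pm by (simp add: X_def)
    fix q assume "q \<in> ?Q"
    then show "projective_norm (Suc n) (D q) \<le> 2 * (1 / real m) * (coord_dev (Suc n) \<theta> p + coord_dev (Suc n) \<theta> q) / \<eta>\<^sup>2"
      unfolding D_def[abs_def]
      by (intro shift_comparison[OF g b1 b \<theta> pm(1) _ _ _ \<eta>]) (use pm in auto)
  qed
  also have "(\<Sum>q\<in>?Q. 2 * (1 / real m) * (coord_dev (Suc n) \<theta> p + coord_dev (Suc n) \<theta> q) / \<eta>\<^sup>2)
    = (\<Sum>j<m. 2 / real m * (coord_dev (Suc n) \<theta> p + coord_dev (Suc n) \<theta> (p + j)) / \<eta>\<^sup>2)"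
    by (rule sum.reindex_bij_witness[of _ "\<lambda>j. p + j" "\<lambda>q. q - p"]) auto
  finally show ?thesis unfolding split .
qed

text \<open>
  The exact second moment is a rational function of \<open>p / n\<close> and \<open>1 / n\<close> whose limit is
  \<open>\<theta>\<^sup>2 - 2 * \<theta>\<^sup>2 + \<theta>\<^sup>2\<close>.
\<close>

lemma coord_dev_tendsto_0:
  assumes \<theta>: "0 < \<theta>" "\<theta> < 1" and p: "(\<lambda>n. real (p n) / real n) \<longlonglongrightarrow> \<theta>"
  shows "(\<lambda>n. coord_dev (Suc n) \<theta> (p n + j)) \<longlonglongrightarrow> 0"
    and "eventually (\<lambda>n. 1 \<le> p n \<and> p n + j \<le> Suc n) sequentially"
proof -
  have lim: "(\<lambda>n. (real (p n) + a) / (real n + c)) \<longlonglongrightarrow> \<theta>" for a c :: real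
  proof -
    have "(\<lambda>n. (real (p n) / real n + a / real n) * (real n / (real n + c))) \<longlonglongrightarrow> (\<theta> + 0) * 1"
      by (intro tendsto_intros p) real_asymp+
    moreover have "eventually (\<lambda>n. (real (p n) / real n + a / real n) * (real n / (real n + c)) = (real (p n) + a) / (real n + c)) sequentially"
      using eventually_gt_at_top[of 0] by eventually_elim (simp add: add_divide_distrib[symmetric])
    ultimately show ?thesis by (simp only: tendsto_cong add_0_right mult_1_right)
  qed
  have "eventually (\<lambda>n. (real (p n) + 0) / (real n + 0) > 0) sequentially"
    by (rule order_tendstoD(1)[OF lim \<theta>(1)])
  then have 1: "eventually (\<lambda>n. 1 \<le> p n) sequentially"
    by eventually_elim (auto simp: zero_less_divide_iff)
  have "eventually (\<lambda>n. (real (p n) + real j) / (real n + 1) < 1) sequentially"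
    by (rule order_tendstoD(2)[OF lim \<theta>(2)])
  then have "eventually (\<lambda>n. p n + j \<le> Suc n) sequentially"
    by eventually_elim (simp add: field_simps)
  with 1 show ev: "eventually (\<lambda>n. 1 \<le> p n \<and> p n + j \<le> Suc n) sequentially"
    by (rule eventually_conj)
  have "(\<lambda>n. ((real (p n) + real j) / (real n + 2)) * ((real (p n) + (real j + 1)) / (real n + 3))
      - 2 * \<theta> * ((real (p n) + real j) / (real n + 2)) + \<theta>\<^sup>2) \<longlonglongrightarrow> \<theta> * \<theta> - 2 * \<theta> * \<theta> + \<theta>\<^sup>2"
    by (intro tendsto_intros lim)
  moreover have "eventually (\<lambda>n. ((real (p n) + real j) / (real n + 2)) * ((real (p n) + (real j + 1)) / (real n + 3))
      - 2 * \<theta> * ((real (p n) + real j) / (real n + 2)) + \<theta>\<^sup>2 = coord_dev (Suc n) \<theta> (p n + j)) sequentially"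
    using ev by eventually_elim (subst coord_dev_eq, auto simp: add_ac)
  ultimately show "(\<lambda>n. coord_dev (Suc n) \<theta> (p n + j)) \<longlonglongrightarrow> 0"
    by (simp add: tendsto_cong power2_eq_square)
qed

lemma insertion_error_tendsto_0:
  fixes g :: "real \<Rightarrow> real ^ 'd::finite"
  assumes g: "g \<in> borel_measurable borel" "\<And>r. norm (g r) \<le> 1" and b1: "norm b \<le> 1"
    and b: "\<And>r. s < r \<Longrightarrow> r < t \<Longrightarrow> g r = b" and \<theta>: "s < \<theta>" "\<theta> < t" "0 < \<theta>" "\<theta> < 1"
    and p: "(\<lambda>n. real (p n) / real n) \<longlonglongrightarrow> \<theta>" and e: "0 < e"
  shows "eventually (\<lambda>n. projective_norm (Suc n) (\<lambda>is. (\<integral>u. pure_tensor (ins_word g (p n) n b u) is \<partial>order_stats n)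
      - (\<integral>u. pure_tensor (path_word g (Suc n) u) is \<partial>order_stats (Suc n))) < e) sequentially"
proof -
  define \<eta> where "\<eta> = min (\<theta> - s) (t - \<theta>)"
  \<comment> \<open>Large enough that the averaging error \<open>1 / sqrt m\<close> is below \<open>e / 2\<close>.\<close>
  obtain m :: nat where m: "(2 / e)\<^sup>2 < real m" using reals_Archimedean2 by blast
  then have "sqrt ((2 / e)\<^sup>2) < sqrt (real m)" by (rule real_sqrt_less_mono)
  then have m': "2 / e < sqrt (real m)" using e by simp
  have m0: "0 < m" using m zero_le_power2[of "2 / e"] by (cases m) auto
  have me: "1 / sqrt (real m) < e / 2"
    using m' e m0 by (simp add: field_simps)
  have "(\<lambda>n. \<Sum>j<m. 2 / real m * (coord_dev (Suc n) \<theta> (p n + 0) + coord_dev (Suc n) \<theta> (p n + j)) / \<eta>\<^sup>2)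
    \<longlonglongrightarrow> (\<Sum>j<m. 2 / real m * (0 + 0) / \<eta>\<^sup>2)"
    using \<theta> by (intro tendsto_sum tendsto_intros coord_dev_tendsto_0(1)[OF \<theta>(3,4) p]) (auto simp: \<eta>_def min_def)
  then have "(\<lambda>n. \<Sum>j<m. 2 / real m * (coord_dev (Suc n) \<theta> (p n) + coord_dev (Suc n) \<theta> (p n + j)) / \<eta>\<^sup>2) \<longlonglongrightarrow> 0"
    by simp
  then have "eventually (\<lambda>n. (\<Sum>j<m. 2 / real m * (coord_dev (Suc n) \<theta> (p n) + coord_dev (Suc n) \<theta> (p n + j)) / \<eta>\<^sup>2) < e / 2) sequentially"
    using e by (intro order_tendstoD(2)) auto
  then show ?thesis
    using coord_dev_tendsto_0(2)[OF \<theta>(3,4) p, of m]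
  proof eventually_elim
    case (elim n)
    have "projective_norm (Suc n) (\<lambda>is. (\<integral>u. pure_tensor (ins_word g (p n) n b u) is \<partial>order_stats n)
      - (\<integral>u. pure_tensor (path_word g (Suc n) u) is \<partial>order_stats (Suc n)))
      \<le> 1 / sqrt (real m) + (\<Sum>j<m. 2 / real m * (coord_dev (Suc n) \<theta> (p n) + coord_dev (Suc n) \<theta> (p n + j)) / \<eta>\<^sup>2)"
      by (rule insertion_error_le[OF g b1 b \<theta>(1,2)]) (use elim m0 in \<open>auto simp: \<eta>_def\<close>)
    then show ?case using elim me by linarith
  qed
qed

section \<open>A contraction that detects the inserted vector\<close>

text \<open>
  Coordinates of the form that contracts consecutive slots in pairs. If the number of slots is odd, the last
  one is contracted with the fixed vector \<open>c\<close>. The function \<open>pairing\<close> below gives the values of this form.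
\<close>

fun pair_coeff :: "real ^ 'd \<Rightarrow> 'd list \<Rightarrow> real" where
  "pair_coeff c [] = 1"
| "pair_coeff c [i] = c $ i"
| "pair_coeff c (i # j # is) = of_bool (i = j) * pair_coeff c is"

fun pairing :: "'a::real_inner \<Rightarrow> 'a list \<Rightarrow> real" where
  "pairing c [] = 1"
| "pairing c [v] = v \<bullet> c"
| "pairing c (v # w # vs) = (v \<bullet> w) * pairing c vs"

lemma sum_multi_indices_Suc:
  fixes F :: "'d::finite list \<Rightarrow> real"
  shows "(\<Sum>is | length is = Suc k. F is) = (\<Sum>i\<in>UNIV. \<Sum>is | length is = k. F (i # is))"
proof -
  have "(\<Sum>i\<in>UNIV. \<Sum>is | length is = k. F (i # is)) = (\<Sum>(i, is)\<in>UNIV \<times> {is. length is = k}. F (i # is))"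
    by (rule sum.cartesian_product)
  also have "\<dots> = (\<Sum>is | length is = Suc k. F is)"
    by (rule sum.reindex_bij_witness[of _ "\<lambda>is. (hd is, tl is)" "\<lambda>(i, is). i # is"])
       (auto simp: length_Suc_conv)
  finally show ?thesis ..
qed

lemma multi_indices_0: "{is :: 'd list. length is = 0} = {[]}"
  by auto

lemma sum_pair_coeff:
  fixes vs :: "(real ^ 'd::finite) list"
  shows "(\<Sum>is | length is = length vs. pure_tensor vs is * pair_coeff c is) = pairing c vs"
proof (induction c vs rule: pairing.induct)
  case (1 c)
  then show ?case by (simp add: multi_indices_0 pure_tensor_Nil del: length_0_conv)
next
  case (2 c v)
  then show ?case
    by (simp add: sum_multi_indices_Suc multi_indices_0 pure_tensor_Nil inner_vec_def del: length_0_conv)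
next
  case (3 c v w vs)
  have "(\<Sum>is | length is = length (v # w # vs). pure_tensor (v # w # vs) is * pair_coeff c is)
    = (\<Sum>i\<in>UNIV. \<Sum>j\<in>UNIV. if j = i then v $ i * w $ j * (\<Sum>is | length is = length vs. pure_tensor vs is * pair_coeff c is) else 0)"
  proof -
    have "(\<Sum>is | length is = length vs. pure_tensor (v # w # vs) (i # j # is) * pair_coeff c (i # j # is))
      = (if j = i then v $ i * w $ j * (\<Sum>is | length is = length vs. pure_tensor vs is * pair_coeff c is) else 0)" for i j
      by (cases "j = i") (simp_all add: sum_distrib_left mult_ac)
    then show ?thesis by (simp only: list.size(4) add_Suc_right add_0_right sum_multi_indices_Suc)
  qed
  also have "\<dots> = (v \<bullet> w) * pairing c vs"
    by (simp add: 3 inner_vec_def sum_distrib_right)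
  finally show ?case by simp
qed

lemma abs_pairing_le:
  assumes "norm c \<le> 1"
  shows "\<bar>pairing c vs\<bar> \<le> (\<Prod>v\<leftarrow>vs. norm v)"
  using assms
proof (induction c vs rule: pairing.induct)
  case (2 c v)
  have "\<bar>v \<bullet> c\<bar> \<le> norm v * norm c" by (rule Cauchy_Schwarz_ineq2)
  also have "\<dots> \<le> norm v" using 2 by (simp add: mult_left_le)
  finally show ?case by simp
next
  case (3 c v w vs)
  have "\<bar>v \<bullet> w\<bar> * \<bar>pairing c vs\<bar> \<le> (norm v * norm w) * (\<Prod>v\<leftarrow>vs. norm v)"
    using 3 by (intro mult_mono Cauchy_Schwarz_ineq2) auto
  then show ?case by (simp add: abs_mult mult.assoc)
qed simp

text \<open>
  Contracting one slot with \<open>b\<close> and applying a form \<open>h\<close> to the others. The form \<open>h\<close> is general because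
  the induction over the slots on the left fixes their indices one by one.
\<close>

lemma sum_slot_coeff:
  fixes v b :: "real ^ 'd::finite" and h :: "'d list \<Rightarrow> real"
  shows "(\<Sum>is | length is = Suc (length us + length ws).
      pure_tensor (us @ v # ws) is * (b $ (is ! length us) * h (take (length us) is @ drop (Suc (length us)) is)))
    = (v \<bullet> b) * (\<Sum>is | length is = length us + length ws. pure_tensor (us @ ws) is * h is)"
proof (induction us arbitrary: h)
  case Nil
  have "(\<Sum>i\<in>UNIV. \<Sum>is | length is = length ws. v $ i * b $ i * (pure_tensor ws is * h is))
      = (v \<bullet> b) * (\<Sum>is | length is = length ws. pure_tensor ws is * h is)"
    by (simp add: inner_vec_def sum_product)
  then show ?case
    by (simp add: sum_multi_indices_Suc mult_ac)
next
  case (Cons x us)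
  have "(\<Sum>is | length is = Suc (length (x # us) + length ws).
      pure_tensor ((x # us) @ v # ws) is * (b $ (is ! length (x # us)) * h (take (length (x # us)) is @ drop (Suc (length (x # us))) is)))
    = (\<Sum>i\<in>UNIV. x $ i * (\<Sum>is | length is = Suc (length us + length ws).
      pure_tensor (us @ v # ws) is * (b $ (is ! length us) * h (i # take (length us) is @ drop (Suc (length us)) is))))"
    by (simp add: sum_multi_indices_Suc[of "\<lambda>is. _ is * _ is" "Suc _"] sum_distrib_left mult.assoc)
  also have "\<dots> = (\<Sum>i\<in>UNIV. x $ i * ((v \<bullet> b) * (\<Sum>is | length is = length us + length ws. pure_tensor (us @ ws) is * h (i # is))))"
    by (simp only: Cons.IH[of "\<lambda>is. h (_ # is)"])
  also have "\<dots> = (v \<bullet> b) * (\<Sum>is | length is = length (x # us) + length ws. pure_tensor ((x # us) @ ws) is * h is)"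
    by (simp add: sum_multi_indices_Suc sum_distrib_left mult_ac)
  finally show ?case .
qed

definition slot_coeff :: "real ^ 'd \<Rightarrow> real ^ 'd \<Rightarrow> nat \<Rightarrow> 'd list \<Rightarrow> real" where
  "slot_coeff b c p is = b $ (is ! (p - 1)) * pair_coeff c (take (p - 1) is @ drop p is)"

lemma sum_slot_pair_coeff:
  fixes v b :: "real ^ 'd::finite"
  assumes "length us = p - 1" "1 \<le> p" "length us + length ws = n"
  shows "(\<Sum>is | length is = Suc n. pure_tensor (us @ v # ws) is * slot_coeff b c p is)
    = (v \<bullet> b) * pairing c (us @ ws)"
proof -
  have p: "p = Suc (length us)" using assms by simp
  show ?thesis
    using sum_slot_coeff[where us = us and ws = ws and v = v and b = b and h = "pair_coeff c"]
      sum_pair_coeff[of "us @ ws" c]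
    by (simp add: slot_coeff_def p flip: assms(3))
qed

lemma slot_coeff_contractive:
  fixes vs :: "(real ^ 'd::finite) list"
  assumes "length vs = Suc n" "p \<in> {1..Suc n}" "norm b \<le> 1" "norm c \<le> 1"
  shows "\<bar>\<Sum>is | length is = Suc n. pure_tensor vs is * slot_coeff b c p is\<bar> \<le> (\<Prod>v\<leftarrow>vs. norm v)"
proof -
  define us v ws where "us = take (p - 1) vs" and "v = vs ! (p - 1)" and "ws = drop p vs"
  have vs: "vs = us @ v # ws"
    using assms(1,2) id_take_nth_drop[of "p - 1" vs] by (auto simp: us_def v_def ws_def)
  have us: "length us = p - 1" using assms(1,2) by (auto simp: us_def min_def)
  have len: "length us + length ws = n" using assms(1) by (simp add: vs)
  have "(\<Sum>is | length is = Suc n. pure_tensor vs is * slot_coeff b c p is) = (v \<bullet> b) * pairing c (us @ ws)"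
    using sum_slot_pair_coeff[OF us _ len] assms(2) by (simp add: vs)
  moreover have "\<bar>v \<bullet> b\<bar> * \<bar>pairing c (us @ ws)\<bar> \<le> norm v * (\<Prod>v\<leftarrow>us @ ws. norm v)"
  proof (intro mult_mono abs_pairing_le assms)
    have "\<bar>v \<bullet> b\<bar> \<le> norm v * norm b" by (rule Cauchy_Schwarz_ineq2)
    also have "\<dots> \<le> norm v" using assms by (simp add: mult_left_le)
    finally show "\<bar>v \<bullet> b\<bar> \<le> norm v" .
  qed auto
  ultimately show ?thesis by (simp add: vs abs_mult mult_ac)
qed

text \<open>
  The inserted vector meets only \<open>b\<close>, so its contribution factors out of the expectation.
\<close>

lemma slot_functional_insertion:
  fixes g :: "real \<Rightarrow> real ^ 'd::finite"
  assumes g: "g \<in> borel_measurable borel" "\<And>r. norm (g r) \<le> 1"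
    and p: "p \<in> {1..Suc n}" and x: "norm x \<le> 1"
  shows "(\<Sum>is | length is = Suc n. (\<integral>u. pure_tensor (ins_word g p n x u) is \<partial>order_stats n) * slot_coeff b c p is)
    = (x \<bullet> b) * (\<integral>u. pairing c (path_word g n u) \<partial>order_stats n)"
proof -
  have W: "measurable_word (order_stats n) (Suc n) (ins_word g p n x)"
    by (simp add: measurable_ins_word[OF g p x])
  have "integrable (order_stats n) (\<lambda>u. pure_tensor (ins_word g p n x u) is)" for "is"
    using integrable_mult_word[OF W integrable_const_order_stats, of 1] by simp
  then have "(\<Sum>is | length is = Suc n. (\<integral>u. pure_tensor (ins_word g p n x u) is \<partial>order_stats n) * slot_coeff b c p is)
    = (\<integral>u. (\<Sum>is | length is = Suc n. pure_tensor (ins_word g p n x u) is * slot_coeff b c p is) \<partial>order_stats n)"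
    by simp
  also have "\<dots> = (\<integral>u. (x \<bullet> b) * pairing c (path_word g n u) \<partial>order_stats n)"
  proof (rule Bochner_Integration.integral_cong[OF refl])
    fix u :: "nat \<Rightarrow> real"
    let ?us = "map (\<lambda>i. g (u i)) [1..<p]" and ?ws = "map (\<lambda>i. g (u i)) [p..<Suc n]"
    have "path_word g n u = ?us @ ?ws"
      using p upt_add_eq_append[of 1 p "Suc n - p"] by (simp add: path_word_def map_append[symmetric] del: map_append upt_Suc)
    moreover have "length ?us + length ?ws = n" using p by auto
    ultimately show "(\<Sum>is | length is = Suc n. pure_tensor (ins_word g p n x u) is * slot_coeff b c p is) = (x \<bullet> b) * pairing c (path_word g n u)"
      using sum_slot_pair_coeff[of ?us p ?ws n x b c] p by (simp add: ins_word_def del: upt_Suc)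
  qed
  finally show ?thesis by simp
qed

lemma inner_unit: "norm v = 1 \<Longrightarrow> norm w = 1 \<Longrightarrow> 1 - v \<bullet> w = (norm (v - w))\<^sup>2 / 2"
  for v w :: "'a::real_inner"
  by (simp add: power2_norm_eq_inner inner_diff inner_commute norm_eq_1)

section \<open>The contracted path stays away from zero\<close>

text \<open>
  For \<open>a, b \<le> 1\<close> one has \<open>1 - a * b \<le> (1 - a) + (1 - b)\<close>, so the defects of the pairs add up. The pair
  \<open>(j, j + 1)\<close> has defect \<open>(norm (g (u j) - g (u (j + 1))))\<^sup>2 / 2\<close>, which is charged to the gap \<open>j + 1\<close>;
  an unpaired last point is charged to the last gap and to the summand \<open>e\<close>.
\<close>

lemma pairing_segment_ge:
  fixes g :: "real \<Rightarrow> 'a::real_inner"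
  assumes unit: "\<And>r. 0 < r \<Longrightarrow> r < 1 \<Longrightarrow> norm (g r) = 1" and c: "norm c = 1"
    and mod: "\<And>r r'. 0 < r \<Longrightarrow> r < 1 \<Longrightarrow> 0 < r' \<Longrightarrow> r' < 1 \<Longrightarrow>
      (norm (g r - g r'))\<^sup>2 \<le> e * \<bar>r - r'\<bar> + K * \<bar>r - r'\<bar>\<^sup>2"
    and modc: "\<And>r. 0 < r \<Longrightarrow> r < 1 \<Longrightarrow> (norm (g r - c))\<^sup>2 \<le> 2 * e + 2 * K * (1 - r)\<^sup>2"
    and e: "0 \<le> e" and K: "0 \<le> K" and u: "u \<in> open_simplex n" and j: "1 \<le> j"
  shows "1 - pairing c (map (\<lambda>i. g (u i)) [j..<Suc n])
    \<le> e + (\<Sum>i\<in>{Suc j..Suc n}. e * gap n u i + K * (gap n u i)\<^sup>2)"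
  using j
proof (induction "Suc n - j" arbitrary: j rule: less_induct)
  case less
  have rng: "0 < u i \<and> u i < 1" if "1 \<le> i" "i \<le> n" for i
    using u that by (auto simp: open_simplex_iff)
  have nonneg: "0 \<le> e * gap n u i + K * (gap n u i)\<^sup>2" for i
    using e K gap_nonneg[OF u] by simp
  consider "n < j" | "j = n" | "j < n" by linarith
  then show ?case
  proof cases
    case 1
    then show ?thesis using e by simp
  next
    case 2
    have "1 - g (u n) \<bullet> c = (norm (g (u n) - c))\<^sup>2 / 2"
      by (rule inner_unit) (use unit rng[of n] less.prems 2 c in auto)
    moreover have "(norm (g (u n) - c))\<^sup>2 \<le> 2 * e + 2 * K * (1 - u n)\<^sup>2"
      by (rule modc) (use rng[of n] less.prems 2 in auto)
    moreover have "gap n u (Suc n) = 1 - u n" using less.prems 2 by (simp add: gap_def node_def)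
    moreover have "0 \<le> e * gap n u (Suc n)" using e gap_nonneg[OF u] by simp
    ultimately show ?thesis using 2 less.prems by simp
  next
    case 3
    let ?a = "g (u j) \<bullet> g (u (Suc j))" and ?b = "pairing c (map (\<lambda>i. g (u i)) [Suc (Suc j)..<Suc n])"
    have ru: "0 < u j" "u j < 1" "0 < u (Suc j)" "u (Suc j) < 1"
      using rng[of j] rng[of "Suc j"] less.prems 3 by auto
    have a1: "?a \<le> 1"
      using Cauchy_Schwarz_ineq2[of "g (u j)" "g (u (Suc j))"] ru unit by simp
    have "(\<Prod>v\<leftarrow>map (\<lambda>i. g (u i)) [Suc (Suc j)..<Suc n]. norm v) \<le> 1"
      by (rule prod_list_norm_le_1) (use rng unit in auto)
    then have b1: "?b \<le> 1"
      using abs_pairing_le[of c "map (\<lambda>i. g (u i)) [Suc (Suc j)..<Suc n]"] c by linarith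
    have "0 \<le> (1 - ?a) * (1 - ?b)" using a1 b1 by simp
    then have prod: "1 - ?a * ?b \<le> (1 - ?a) + (1 - ?b)" by (simp add: algebra_simps)
    have g': "gap n u (Suc j) = u (Suc j) - u j" using less.prems 3 by (simp add: gap_def node_def)
    have "1 - ?a = (norm (g (u j) - g (u (Suc j))))\<^sup>2 / 2"
      by (rule inner_unit) (use ru unit in auto)
    also have "(norm (g (u j) - g (u (Suc j))))\<^sup>2 \<le> e * \<bar>u j - u (Suc j)\<bar> + K * \<bar>u j - u (Suc j)\<bar>\<^sup>2"
      by (rule mod[OF ru])
    also have "\<bar>u j - u (Suc j)\<bar> = gap n u (Suc j)"
      using gap_nonneg[OF u, of "Suc j"] g' by simp
    finally have A: "1 - ?a \<le> e * gap n u (Suc j) + K * (gap n u (Suc j))\<^sup>2"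
      using nonneg[of "Suc j"] by simp
    have B: "1 - ?b \<le> e + (\<Sum>i\<in>{Suc (Suc (Suc j))..Suc n}. e * gap n u i + K * (gap n u i)\<^sup>2)"
      by (rule less.hyps) (use 3 in auto)
    have "[j..<Suc n] = j # Suc j # [Suc (Suc j)..<Suc n]"
      using 3 by (simp add: upt_conv_Cons del: upt_Suc)
    then have "1 - pairing c (map (\<lambda>i. g (u i)) [j..<Suc n]) = 1 - ?a * ?b"
      by (simp del: upt_Suc)
    moreover have "{Suc j..Suc n} = insert (Suc j) (insert (Suc (Suc j)) {Suc (Suc (Suc j))..Suc n})"
      using 3 by auto
    ultimately show ?thesis
      using prod A B nonneg[of "Suc (Suc j)"] by simp
  qed
qed

text \<open>
  The terms linear in the gaps are bounded by \<open>e\<close> because the gaps sum to \<open>1\<close>. There are \<open>n + 1\<close> squared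
  gaps, each with expectation \<open>2 / ((n + 1) * (n + 2))\<close>.
\<close>

lemma expectation_pairing_ge:
  fixes g :: "real \<Rightarrow> real ^ 'd::finite"
  assumes g: "g \<in> borel_measurable borel" "\<And>r. norm (g r) \<le> 1"
    and unit: "\<And>r. 0 < r \<Longrightarrow> r < 1 \<Longrightarrow> norm (g r) = 1" and c: "norm c = 1"
    and mod: "\<And>r r'. 0 < r \<Longrightarrow> r < 1 \<Longrightarrow> 0 < r' \<Longrightarrow> r' < 1 \<Longrightarrow>
      (norm (g r - g r'))\<^sup>2 \<le> e * \<bar>r - r'\<bar> + K * \<bar>r - r'\<bar>\<^sup>2"
    and modc: "\<And>r. 0 < r \<Longrightarrow> r < 1 \<Longrightarrow> (norm (g r - c))\<^sup>2 \<le> 2 * e + 2 * K * (1 - r)\<^sup>2"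
    and e: "0 \<le> e" and K: "0 \<le> K"
  shows "1 - 2 * e - 2 * K / (real n + 2) \<le> (\<integral>u. pairing c (path_word g n u) \<partial>order_stats n)"
proof -
  let ?O = "order_stats n"
  let ?R = "\<lambda>u. 2 * e + K * (\<Sum>i\<in>{1..Suc n}. (gap n u i)\<^sup>2)"
  have ig: "integrable ?O (\<lambda>u. (gap n u i)\<^sup>2)" for i
    using integrable_gap_mult[of n i i] by (simp add: power2_eq_square)
  have iR: "integrable ?O ?R"
    using ig integrable_const_order_stats by (intro Bochner_Integration.integrable_add integrable_mult_right Bochner_Integration.integrable_sum)
  have "(\<integral>u. 1 - ?R u \<partial>?O) = 1 - (2 * e + K * (\<Sum>i\<in>{1..Suc n}. \<integral>u. (gap n u i)\<^sup>2 \<partial>?O))"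
    using ig iR integrable_const_order_stats
    by (simp add: integral_const_order_stats del: lebesgue_integral_const sum.cl_ivl_Suc)
  also have "(\<Sum>i\<in>{1..Suc n}. \<integral>u. (gap n u i)\<^sup>2 \<partial>?O) = (\<Sum>i\<in>{1..Suc n}. 2 / ((real n + 1) * (real n + 2)))"
    by (rule sum.cong) (simp_all add: power2_eq_square expectation_gap_mult)
  also have "\<dots> = 2 / (real n + 2)"
    by (simp add: divide_simps del: sum.cl_ivl_Suc)
  finally have E: "1 - 2 * e - 2 * K / (real n + 2) = (\<integral>u. 1 - ?R u \<partial>?O)" by simp
  also have "\<dots> \<le> (\<integral>u. pairing c (path_word g n u) \<partial>?O)"
  proof (rule integral_mono_AE)
    show "integrable ?O (\<lambda>u. 1 - ?R u)"
      using iR integrable_const_order_stats by (rule Bochner_Integration.integrable_diff[rotated])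
    have W: "measurable_word ?O n (path_word g n)"
      by (simp add: measurable_path_word[OF g])
    have len: "length (path_word g n u) = n" for u by (simp add: path_word_def)
    have "integrable ?O (\<lambda>u. \<Sum>is | length is = n. pure_tensor (path_word g n u) is * pair_coeff c is)"
      using integrable_mult_word[OF W integrable_const_order_stats, of 1] by simp
    then show "integrable ?O (\<lambda>u. pairing c (path_word g n u))"
      using sum_pair_coeff[of "path_word g n _" c] by (simp add: len)
    show "AE u in ?O. 1 - ?R u \<le> pairing c (path_word g n u)"
      using AE_order_stats
    proof eventually_elim
      case (elim u)
      have "1 - pairing c (path_word g n u) \<le> e + (\<Sum>i\<in>{Suc 1..Suc n}. e * gap n u i + K * (gap n u i)\<^sup>2)"
        unfolding path_word_def by (rule pairing_segment_ge[OF unit c mod modc e K elim]) auto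
      also have "(\<Sum>i\<in>{Suc 1..Suc n}. e * gap n u i + K * (gap n u i)\<^sup>2) \<le> (\<Sum>i\<in>{1..Suc n}. e * gap n u i + K * (gap n u i)\<^sup>2)"
        by (rule sum_mono2) (use e K gap_nonneg[OF elim] in auto)
      also have "\<dots> = e * (\<Sum>i\<in>{1..Suc n}. gap n u i) + K * (\<Sum>i\<in>{1..Suc n}. (gap n u i)\<^sup>2)"
        by (simp only: sum.distrib sum_distrib_left)
      finally show ?case by (simp only: sum_gap_all) simp
    qed
  qed
  finally show ?thesis .
qed


section \<open>Regularity of the direction\<close>

lemma norm_diff_le_modulus:
  fixes f :: "real \<Rightarrow> 'a::real_normed_vector"
  assumes unit: "\<And>r. r \<in> {0<..<1} \<Longrightarrow> norm (f r) = 1"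
    and u: "u \<in> {0<..<1}" "v \<in> {0<..<1}" "\<bar>u - v\<bar> \<le> h"
  shows "norm (f u - f v) \<le> modulus_of_continuity f h"
  unfolding modulus_of_continuity_def
proof (rule cSUP_upper2[where x = "(u, v)"])
  show "bdd_above ((\<lambda>(u, v). norm (f u - f v)) ` {(u, v). u \<in> {0<..<1} \<and> v \<in> {0<..<1} \<and> \<bar>u - v\<bar> \<le> h})"
  proof (rule bdd_aboveI2[where M = 2], clarify)
    fix a b :: real assume "a \<in> {0<..<1}" "b \<in> {0<..<1}"
    then show "norm (f a - f b) \<le> 2" using norm_triangle_ineq4[of "f a" "f b"] unit by simp
  qed
qed (use u in auto)

text \<open>
  For small \<open>h = \<bar>u - v\<bar>\<close> the squared modulus is at most \<open>e * h powr (3/2) \<le> e * h\<close>; for larger \<open>h\<close> the bound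
  \<open>2\<close> on the distance of two unit vectors is absorbed by the quadratic term.
\<close>

lemma modulus_quadratic_bound:
  fixes f :: "real \<Rightarrow> 'a::real_normed_vector"
  assumes unit: "\<And>r. r \<in> {0<..<1} \<Longrightarrow> norm (f r) = 1"
    and mod: "modulus_of_continuity f \<in> o[at_right 0](\<lambda>h. h powr (3/4))" and e: "0 < e"
  obtains K where "0 < K" "\<And>u v. u \<in> {0<..<1} \<Longrightarrow> v \<in> {0<..<1} \<Longrightarrow>
    (norm (f u - f v))\<^sup>2 \<le> e * \<bar>u - v\<bar> + K * \<bar>u - v\<bar>\<^sup>2"
proof -
  have "eventually (\<lambda>h. norm (modulus_of_continuity f h) \<le> sqrt e * norm (h powr (3/4))) (at_right 0)"
    by (rule landau_o.smallD[OF mod]) (use e in simp)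
  then obtain \<eta> where \<eta>: "0 < \<eta>" and
    le: "\<And>h. 0 < h \<Longrightarrow> h < \<eta> \<Longrightarrow> \<bar>modulus_of_continuity f h\<bar> \<le> sqrt e * h powr (3/4)"
    unfolding eventually_at_right_field by auto
  have "(norm (f u - f v))\<^sup>2 \<le> e * \<bar>u - v\<bar> + 4 / \<eta>\<^sup>2 * \<bar>u - v\<bar>\<^sup>2"
    if uv: "u \<in> {0<..<1}" "v \<in> {0<..<1}" for u v
  proof -
    let ?h = "\<bar>u - v\<bar>"
    consider "?h = 0" | "0 < ?h" "?h < \<eta>" | "\<eta> \<le> ?h" by linarith
    then show ?thesis
    proof cases
      case 2
      have h1: "?h \<le> 1" using uv by auto
      have "norm (f u - f v) \<le> sqrt e * ?h powr (3/4)"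
        using norm_diff_le_modulus[where f = f, OF unit uv order_refl] le[OF 2] by linarith
      then have "(norm (f u - f v))\<^sup>2 \<le> (sqrt e * ?h powr (3/4))\<^sup>2" by (rule power_mono) simp
      also have "\<dots> = e * (?h powr (3/4))\<^sup>2" using e by (simp add: power_mult_distrib)
      also have "(?h powr (3/4))\<^sup>2 = ?h powr (3/2)"
        using 2 by (simp add: power2_eq_square powr_add[symmetric])
      also have "e * ?h powr (3/2) \<le> e * ?h powr 1"
        using 2 h1 e by (intro mult_left_mono powr_mono') auto
      also have "e * ?h powr 1 = e * ?h" using 2 by simp
      finally show ?thesis by (simp add: add_increasing2)
    next
      case 3
      have "norm (f u - f v) \<le> 2" using norm_triangle_ineq4[of "f u" "f v"] unit uv by simp
      then have "(norm (f u - f v))\<^sup>2 \<le> 2\<^sup>2" by (rule power_mono) simp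
      also have "\<dots> \<le> 4 / \<eta>\<^sup>2 * ?h\<^sup>2"
        using power_mono[OF 3, of 2] \<eta> by (simp add: field_simps)
      finally show ?thesis using e by (simp add: add_increasing)
    qed simp
  qed
  then show ?thesis using \<eta> by (intro that[of "4 / \<eta>\<^sup>2"]) auto
qed

lemma continuous_on_of_quadratic_bound:
  fixes f :: "real \<Rightarrow> 'a::real_normed_vector"
  assumes "\<And>u v. u \<in> S \<Longrightarrow> v \<in> S \<Longrightarrow> (norm (f u - f v))\<^sup>2 \<le> e * \<bar>u - v\<bar> + K * \<bar>u - v\<bar>\<^sup>2"
  shows "continuous_on S f"
  unfolding continuous_on_def
proof
  fix v assume v: "v \<in> S"
  have lim: "((\<lambda>u. sqrt (e * \<bar>u - v\<bar> + K * \<bar>u - v\<bar>\<^sup>2)) \<longlongrightarrow> sqrt (e * \<bar>v - v\<bar> + K * \<bar>v - v\<bar>\<^sup>2)) (at v within S)"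
    by (intro tendsto_intros)
  have "((\<lambda>u. f u - f v) \<longlongrightarrow> 0) (at v within S)"
  proof (rule Lim_null_comparison)
    show "eventually (\<lambda>u. norm (f u - f v) \<le> sqrt (e * \<bar>u - v\<bar> + K * \<bar>u - v\<bar>\<^sup>2)) (at v within S)"
      unfolding eventually_at_filter
      by (rule always_eventually) (use assms v in \<open>auto intro!: real_le_rsqrt simp del: power2_abs\<close>)
  qed (use lim in simp)
  then show "(f \<longlongrightarrow> f v) (at v within S)" by (simp add: LIM_zero_iff)
qed

lemma direction_eq_on_linear_piece:
  fixes \<gamma> f :: "real \<Rightarrow> 'a::real_normed_vector"
  assumes deriv: "\<And>r. r \<in> {0<..<1} \<Longrightarrow> (\<gamma> has_vector_derivative f r) (at r)"
    and st: "{s..t} \<subseteq> {0..1}" and lin: "linear_on_interval \<gamma> s t"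
    and r: "s < r" "r < t" "s < r'" "r' < t"
  shows "f r = f r'"
proof -
  obtain a b where ab: "\<And>u. u \<in> {s..t} \<Longrightarrow> \<gamma> u = a + u *\<^sub>R b"
    using lin by (auto simp: linear_on_interval_def)
  have st': "0 \<le> s" "t \<le> 1" using st r by auto
  have "f q = b" if "s < q" "q < t" for q
  proof -
    have "((\<lambda>u. a + u *\<^sub>R b) has_vector_derivative b) (at q)"
      by (auto intro!: derivative_eq_intros)
    then have "(\<gamma> has_vector_derivative b) (at q)"
      by (rule has_vector_derivative_transform_within_open[where S = "{s<..<t}"]) (use ab that in auto)
    moreover have "(\<gamma> has_vector_derivative f q) (at q)"
      by (rule deriv) (use that st' in auto)
    ultimately show ?thesis by (rule vector_derivative_unique_at[symmetric])
  qed
  then show ?thesis using r by simp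
qed

lemma insertion_eq_expectation:
  fixes f :: "real \<Rightarrow> real ^ 'd::finite"
  assumes g: "g \<in> borel_measurable borel" "\<And>r. norm (g r) \<le> 1"
    and fg: "\<And>r. 0 < r \<Longrightarrow> r < 1 \<Longrightarrow> f r = g r" and p: "p \<in> {1..Suc n}" and x: "norm x \<le> 1"
  shows "insertion f p n x is = (\<integral>u. pure_tensor (ins_word g p n x u) is \<partial>order_stats n)"
  unfolding insertion_def
proof (rule simplex_integral_eq_order_stats)
  show "(\<lambda>u. pure_tensor (ins_word g p n x u) is) \<in> borel_measurable (cube_measure n)"
    by (rule pure_tensor_measurable_word[OF measurable_ins_word[OF g p x]])
  fix u assume u: "u \<in> open_simplex n"
  have "map (\<lambda>i. f (u i)) [1..<p] @ [x] @ map (\<lambda>i. f (u i)) [p..<Suc n] = ins_word g p n x u"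
    using u p unfolding ins_word_def open_simplex_iff
    by (intro arg_cong2[where f = append] map_cong refl fg) (auto simp del: upt_Suc)
  then show "pure_tensor (map (\<lambda>i. f (u i)) [1..<p] @ [x] @ map (\<lambda>i. f (u i)) [p..<Suc n]) is
    = pure_tensor (ins_word g p n x u) is" by simp
qed

lemma normalised_signature_eq_expectation:
  fixes f :: "real \<Rightarrow> real ^ 'd::finite"
  assumes g: "g \<in> borel_measurable borel" "\<And>r. norm (g r) \<le> 1"
    and fg: "\<And>r. 0 < r \<Longrightarrow> r < 1 \<Longrightarrow> f r = g r"
  shows "normalised_signature f n is = (\<integral>u. pure_tensor (path_word g n u) is \<partial>order_stats n)"
  unfolding normalised_signature_def
proof (rule simplex_integral_eq_order_stats)
  show "(\<lambda>u. pure_tensor (path_word g n u) is) \<in> borel_measurable (cube_measure n)"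
    by (rule pure_tensor_measurable_word[OF measurable_path_word[OF g]])
  fix u assume u: "u \<in> open_simplex n"
  have "map (\<lambda>i. f (u i)) [1..<Suc n] = path_word g n u"
    using u unfolding path_word_def open_simplex_iff
    by (intro map_cong refl fg) (auto simp del: upt_Suc)
  then show "pure_tensor (map (\<lambda>i. f (u i)) [1..<Suc n]) is = pure_tensor (path_word g n u) is" by simp
qed

lemma insertion_position_limit:
  assumes \<theta>: "0 < \<theta>" "\<theta> < 1"
  shows "(\<lambda>n. real (nat \<lfloor>\<theta> * (real n + 2)\<rfloor>) / real n) \<longlonglongrightarrow> \<theta>"
proof (rule tendsto_sandwich)
  have b: "\<theta> * (real n + 2) - 1 \<le> real (nat \<lfloor>\<theta> * (real n + 2)\<rfloor>) \<and> real (nat \<lfloor>\<theta> * (real n + 2)\<rfloor>) \<le> \<theta> * (real n + 2)" for n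
  proof -
    have "0 \<le> \<theta> * (real n + 2)" using \<theta> by simp
    then have "real (nat \<lfloor>\<theta> * (real n + 2)\<rfloor>) = of_int \<lfloor>\<theta> * (real n + 2)\<rfloor>" by simp
    then show ?thesis by linarith
  qed
  show "eventually (\<lambda>n. (\<theta> * (real n + 2) - 1) / real n \<le> real (nat \<lfloor>\<theta> * (real n + 2)\<rfloor>) / real n) sequentially"
    using b by (intro always_eventually allI divide_right_mono) auto
  show "eventually (\<lambda>n. real (nat \<lfloor>\<theta> * (real n + 2)\<rfloor>) / real n \<le> (\<theta> * (real n + 2)) / real n) sequentially"
    using b by (intro always_eventually allI divide_right_mono) auto
  show "(\<lambda>n. (\<theta> * (real n + 2) - 1) / real n) \<longlonglongrightarrow> \<theta>" by real_asymp
  show "(\<lambda>n. \<theta> * (real n + 2) / real n) \<longlonglongrightarrow> \<theta>" by real_asymp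
qed

section \<open>Convergence of the minimisers\<close>

text \<open>
  Apply the contracting form to both errors. The tensor \<open>T\<close>, later the signature, cancels in the difference
  of the two values, which leaves the difference of the values at \<open>I b\<close> and \<open>I x\<close>.
\<close>

lemma insertion_separation:
  fixes g :: "real \<Rightarrow> real ^ 'd::finite"
  assumes g: "g \<in> borel_measurable borel" "\<And>r. norm (g r) \<le> 1"
    and fg: "\<And>r. 0 < r \<Longrightarrow> r < 1 \<Longrightarrow> f r = g r" and p: "p \<in> {1..Suc n}"
    and x: "norm x = 1" and b: "norm b = 1" and c: "norm c = 1" and T: "of_order (Suc n) T"
  shows "\<bar>1 - x \<bullet> b\<bar> * \<bar>\<integral>u. pairing c (path_word g n u) \<partial>order_stats n\<bar>
    \<le> projective_norm (Suc n) (insertion f p n x - T) + projective_norm (Suc n) (insertion f p n b - T)"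
proof -
  define \<phi> where "\<phi> S = (\<Sum>is | length is = Suc n. S is * slot_coeff b c p is)" for S :: "'d tensor"
  have ins: "\<phi> (insertion f p n y) = (y \<bullet> b) * (\<integral>u. pairing c (path_word g n u) \<partial>order_stats n)"
    and le: "\<bar>\<phi> (insertion f p n y - T)\<bar> \<le> projective_norm (Suc n) (insertion f p n y - T)"
    if y: "norm y \<le> 1" for y
  proof -
    have eq: "insertion f p n y = (\<lambda>is. \<integral>u. pure_tensor (ins_word g p n y u) is \<partial>order_stats n)"
      by (rule ext) (rule insertion_eq_expectation[OF g fg p y])
    show "\<phi> (insertion f p n y) = (y \<bullet> b) * (\<integral>u. pairing c (path_word g n u) \<partial>order_stats n)"
      unfolding \<phi>_def eq by (rule slot_functional_insertion[OF g p y])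
    have "of_order (Suc n) (insertion f p n y)"
      using of_order_integral_word[OF measurable_ins_word[OF g p y], of "\<lambda>_. 1"]
      by (auto simp: eq of_order_def length_ins_word[OF p] pure_tensor_def)
    then have o: "of_order (Suc n) (insertion f p n y - T)"
      using T by (simp add: of_order_def)
    show "\<bar>\<phi> (insertion f p n y - T)\<bar> \<le> projective_norm (Suc n) (insertion f p n y - T)"
      unfolding \<phi>_def by (rule functional_le_projective_norm[OF o]) (auto intro!: slot_coeff_contractive simp: b c p[simplified])
  qed
  have "\<phi> (insertion f p n y - T) = \<phi> (insertion f p n y) - \<phi> T" for y
    by (simp add: \<phi>_def left_diff_distrib sum_subtractf)
  then have "\<phi> (insertion f p n b - T) - \<phi> (insertion f p n x - T)
    = (1 - x \<bullet> b) * (\<integral>u. pairing c (path_word g n u) \<partial>order_stats n)"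
    using ins[of x] ins[of b] x b by (simp add: left_diff_distrib norm_eq_1)
  then have "\<bar>1 - x \<bullet> b\<bar> * \<bar>\<integral>u. pairing c (path_word g n u) \<partial>order_stats n\<bar>
    = \<bar>\<phi> (insertion f p n b - T) - \<phi> (insertion f p n x - T)\<bar>"
    by (simp add: abs_mult)
  then show ?thesis using le[of x] le[of b] x b by simp
qed

theorem theorem5p3:
  fixes \<gamma> f :: "real \<Rightarrow> real ^ 'd::finite"
    and s t \<theta> :: real
    and p :: "nat \<Rightarrow> nat"
    and x :: "nat \<Rightarrow> real ^ 'd"
  assumes "continuous_on {0..1} \<gamma>"
    and "\<And>r. r \<in> {0<..<1} \<Longrightarrow> (\<gamma> has_vector_derivative f r) (at r)"
    and "\<And>r. r \<in> {0<..<1} \<Longrightarrow> norm (f r) = 1"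
    and "modulus_of_continuity f \<in> o[at_right 0](\<lambda>h. h powr (3/4))"
    and "{s..t} \<subseteq> {0..1}"
    and "linear_on_interval \<gamma> s t"
    and "\<theta> \<in> {s<..<t}"
    and "\<And>n. p n = nat \<lfloor>\<theta> * (real n + 2)\<rfloor>"
    and "\<And>n. n \<ge> 1 \<Longrightarrow> p n \<in> {1..n+1} \<Longrightarrow>
           is_arg_min
             (\<lambda>y. projective_norm (n+1) (insertion f (p n) n y - normalised_signature f (n+1)))
             (\<lambda>y. norm y = 1) (x n)"
  shows "x \<longlonglongrightarrow> f \<theta>"
proof -
  define b where "b = f \<theta>"
  have st: "0 \<le> s" "t \<le> 1" "s < \<theta>" "\<theta> < t" using assms(5,7) by auto
  then have \<theta>: "0 < \<theta>" "\<theta> < 1" by auto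
  have fb: "f r = b" if "s < r" "r < t" for r
    unfolding b_def by (rule direction_eq_on_linear_piece[OF assms(2,5,6)]) (use that st in auto)
  have b: "norm b = 1" using assms(3) \<theta> by (simp add: b_def)
  \<comment> \<open>The values of \<open>f\<close> outside \<open>(0, 1)\<close> are arbitrary; \<open>g\<close> is Borel measurable and bounded by \<open>1\<close> everywhere.\<close>
  define g where "g r = (if r \<in> {0<..<1} then f r else 0)" for r
  have fg: "\<And>r. 0 < r \<Longrightarrow> r < 1 \<Longrightarrow> f r = g r" and g1: "\<And>r. norm (g r) \<le> 1"
    and gb: "\<And>r. s < r \<Longrightarrow> r < t \<Longrightarrow> g r = b"
    using assms(3) fb st by (auto simp: g_def)
  \<comment> \<open>Any coefficient below \<open>1/2\<close> keeps the expected contraction away from \<open>0\<close> for large \<open>n\<close>; with \<open>1/8\<close> it is at least \<open>1/2\<close>.\<close>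
  obtain K where K: "0 < K" and Kf: "\<And>u v. u \<in> {0<..<1} \<Longrightarrow> v \<in> {0<..<1} \<Longrightarrow>
    (norm (f u - f v))\<^sup>2 \<le> 1/8 * \<bar>u - v\<bar> + K * \<bar>u - v\<bar>\<^sup>2"
    using modulus_quadratic_bound[where f = f and e = "1/8", OF assms(3,4)] by (metis zero_less_divide_1_iff zero_less_numeral)
  have "continuous_on {0<..<1} f" using Kf by (rule continuous_on_of_quadratic_bound)
  then have "(\<lambda>r. indicator {0<..<1} r *\<^sub>R f r) \<in> borel_measurable borel"
    by (intro borel_measurable_continuous_on_indicator) auto
  also have "(\<lambda>r. indicator {0<..<1} r *\<^sub>R f r) = g" by (auto simp: g_def indicator_def)
  finally have gm: "g \<in> borel_measurable borel" .
  note g = gm g1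
  \<comment> \<open>A vector \<open>c\<close> for the unpaired last slot: the direction at a point \<open>1 - \<rho>\<close> close to the end.\<close>
  obtain c where c: "norm c = 1" and
    modc: "\<And>r. 0 < r \<Longrightarrow> r < 1 \<Longrightarrow> (norm (g r - c))\<^sup>2 \<le> 2 * (1/8) + 2 * K * (1 - r)\<^sup>2"
  proof -
    \<comment> \<open>The bounds on \<open>\<rho>\<close> make \<open>2 * K * \<rho>\<^sup>2 \<le> 1/16\<close>.\<close>
    define \<rho> where "\<rho> = min (1/2) (1 / (16 * (K + 1)))"
    have \<rho>: "0 < \<rho>" "\<rho> \<le> 1/2" using K by (auto simp: \<rho>_def)
    have "\<rho> * K \<le> 1 / (16 * (K + 1)) * K" using K by (intro mult_right_mono) (auto simp: \<rho>_def)
    also have "\<dots> \<le> 1/16" using K by (simp add: field_simps)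
    finally have "\<rho> * (\<rho> * K) \<le> 1/2 * (1/16)" using \<rho> K by (intro mult_mono) auto
    then have \<rho>K: "2 * K * \<rho>\<^sup>2 \<le> 1/16" by (simp add: power2_eq_square mult_ac)
    have "(norm (g r - f (1 - \<rho>)))\<^sup>2 \<le> 2 * (1/8) + 2 * K * (1 - r)\<^sup>2" if r: "0 < r" "r < 1" for r
    proof -
      have "(norm (g r - f (1 - \<rho>)))\<^sup>2 \<le> 1/8 * \<bar>r - (1 - \<rho>)\<bar> + K * \<bar>r - (1 - \<rho>)\<bar>\<^sup>2"
        using Kf[of r "1 - \<rho>"] r \<rho> fg[OF r] by simp
      moreover have "\<bar>r - (1 - \<rho>)\<bar> \<le> 1" using r \<rho> by (simp add: abs_if)
      moreover have "\<bar>r - (1 - \<rho>)\<bar>\<^sup>2 \<le> 2 * (1 - r)\<^sup>2 + 2 * \<rho>\<^sup>2"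
        using zero_le_power2[of "(1 - r) + \<rho>"] by (simp add: power2_eq_square algebra_simps)
      then have "K * \<bar>r - (1 - \<rho>)\<bar>\<^sup>2 \<le> K * (2 * (1 - r)\<^sup>2 + 2 * \<rho>\<^sup>2)"
        using K by (intro mult_left_mono) auto
      ultimately show ?thesis using \<rho>K by (simp add: algebra_simps)
    qed
    then show ?thesis using that[of "f (1 - \<rho>)"] assms(3)[of "1 - \<rho>"] \<rho> by auto
  qed
  have half: "eventually (\<lambda>n. 1/2 \<le> (\<integral>u. pairing c (path_word g n u) \<partial>order_stats n)) sequentially"
  proof -
    have "(\<lambda>n. 2 * K / (real n + 2)) \<longlonglongrightarrow> 0" by real_asymp
    then have "eventually (\<lambda>n. 2 * K / (real n + 2) < 1/4) sequentially"
      by (rule order_tendstoD) simp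
    then show ?thesis
    proof eventually_elim
      case (elim n)
      have "1 - 2 * (1/8) - 2 * K / (real n + 2) \<le> (\<integral>u. pairing c (path_word g n u) \<partial>order_stats n)"
      proof (rule expectation_pairing_ge[OF g _ c _ modc])
        show "norm (g r) = 1" if "0 < r" "r < 1" for r using that assms(3) by (simp add: g_def)
        show "(norm (g r - g r'))\<^sup>2 \<le> 1/8 * \<bar>r - r'\<bar> + K * \<bar>r - r'\<bar>\<^sup>2"
          if "0 < r" "r < 1" "0 < r'" "r' < 1" for r r'
          using Kf[of r r'] that by (simp add: g_def)
      qed (use K in auto)
      then show ?case using elim by linarith
    qed
  qed
  have plim: "(\<lambda>n. real (p n) / real n) \<longlonglongrightarrow> \<theta>"
    unfolding assms(8) by (rule insertion_position_limit[OF \<theta>])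
  have pin: "eventually (\<lambda>n. p n \<in> {1..n+1}) sequentially"
    using coord_dev_tendsto_0(2)[OF \<theta> plim, of 0] by eventually_elim auto
  have unit_x: "eventually (\<lambda>n. norm (x n) = 1) sequentially"
    using pin eventually_ge_at_top[of 1]
    by eventually_elim (use assms(9) in \<open>auto simp: is_arg_min_def\<close>)
  have "(\<lambda>n. x n \<bullet> b) \<longlonglongrightarrow> 1"
  proof (rule tendstoI)
    fix e :: real assume e: "0 < e"
    then have "0 < e / 4" by simp
    have "eventually (\<lambda>n. projective_norm (Suc n) (\<lambda>is. (\<integral>u. pure_tensor (ins_word g (p n) n b u) is \<partial>order_stats n)
      - (\<integral>u. pure_tensor (path_word g (Suc n) u) is \<partial>order_stats (Suc n))) < e / 4) sequentially"
      by (rule insertion_error_tendsto_0[OF g eq_refl[OF b] _ st(3,4) \<theta> plim \<open>0 < e / 4\<close>]) (rule gb)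
    from this half pin eventually_ge_at_top[of 1] unit_x
    show "eventually (\<lambda>n. dist (x n \<bullet> b) 1 < e) sequentially"
    proof eventually_elim
      case (elim n)
      let ?E = "\<lambda>y. projective_norm (Suc n) (insertion f (p n) n y - normalised_signature f (Suc n))"
      have pn: "p n \<in> {1..Suc n}" using elim by simp
      have S: "normalised_signature f (Suc n) is = (\<integral>u. pure_tensor (path_word g (Suc n) u) is \<partial>order_stats (Suc n))" for "is"
        by (rule normalised_signature_eq_expectation[OF g fg])
      have I: "insertion f (p n) n b is = (\<integral>u. pure_tensor (ins_word g (p n) n b u) is \<partial>order_stats n)" for "is"
        by (rule insertion_eq_expectation[OF g fg pn eq_refl[OF b]])
      have "?E b < e / 4" using elim(1) by (simp add: fun_diff_def S I)
      moreover have "?E (x n) \<le> ?E b"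
        using assms(9)[of n] elim b by (force simp: is_arg_min_def)
      moreover have "\<bar>1 - x n \<bullet> b\<bar> * \<bar>\<integral>u. pairing c (path_word g n u) \<partial>order_stats n\<bar> \<le> ?E (x n) + ?E b"
        by (rule insertion_separation[OF g fg pn _ b c]) (use elim in \<open>auto simp: of_order_def S pure_tensor_def path_word_def\<close>)
      moreover have "\<bar>1 - x n \<bullet> b\<bar> * (1/2) \<le> \<bar>1 - x n \<bullet> b\<bar> * \<bar>\<integral>u. pairing c (path_word g n u) \<partial>order_stats n\<bar>"
        using elim(2) by (intro mult_left_mono) auto
      ultimately have "\<bar>1 - x n \<bullet> b\<bar> * (1/2) < e / 4 + e / 4"
        by (meson add_strict_mono le_less_trans order_trans)
      then have "\<bar>1 - x n \<bullet> b\<bar> < e" by simp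
      then show ?case by (simp add: dist_real_def abs_minus_commute)
    qed
  qed
  then have "(\<lambda>n. sqrt (2 * (1 - x n \<bullet> b))) \<longlonglongrightarrow> sqrt (2 * (1 - 1))"
    by (intro tendsto_intros)
  moreover have "eventually (\<lambda>n. sqrt (2 * (1 - x n \<bullet> b)) = norm (x n - b)) sequentially"
    using unit_x by eventually_elim (simp add: inner_unit b)
  ultimately have "(\<lambda>n. norm (x n - b)) \<longlonglongrightarrow> 0"
    by (simp add: tendsto_cong)
  then show ?thesis
    unfolding b_def by (simp add: tendsto_norm_zero_iff LIM_zero_iff)
qed

end
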